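(* In the setting described in the context, let $\widehat{\mathscr M}^{(t)}$ be the step-line moment matrix of the transformed Jacobi vector $\widehat{\mathbf U}^{(t)}$ on $(0,c_t)$ with columns $x^{\beta_i}$, and let $\mathscr M^{\mathrm L}$ be the step-line moment matrix of the Laguerre vector of the first kind $\mathbf U^{\mathrm L}$ on $(0,\infty)$ with the same columns. Fix $K$. Assume that every leading minor of the following shifted matrices used up to level $K$ in either Christoffel chain is nonzero: $$\mathscr M^{\mathrm L},\qquad\Lambda^a\mathscr M^{\mathrm L}\ (0\le a\le q),\qquad\mathscr M^{\mathrm L}(\Lambda^b)^{\mathsf T}\ (0\le b\le p).$$ Then the corresponding minors for $\widehat{\mathscr M}^{(t)}$ are nonzero for all sufficiently large $t$. At every index not exceeding $K$, as $t\to+\infty$, the Gauss–Borel forms $\widehat{\mathsf A}_N^{(t)},\widehat{\mathsf B}_N^{(t)}$ (coefficientwise), the recurrence coefficients (entries of the recurrence matrix), and the entries of the normalized lower and upper bidiagonal factors converge to their counterparts for the Laguerre system of the first kind, the forms converging to $\mathsf A_N^{\mathrm L},\mathsf B_N^{\mathrm L}$.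
   Context: Weights. $\mathcal B_{a,b}(x)=\frac{x^a(1-x)^{b-a-1}}{\Gamma(b-a)}\mathbf 1_{(0,1)}(x)$, $-1<a<b$; $\mathcal G_a(x)=x^a\mathrm e^{-x}\mathbf 1_{(0,\infty)}(x)$; Mellin convolution $(f*g)(x)=\int_0^\infty f(u)g(x/u)\frac{\mathrm du}u$. Let $p\ge1$, $q=r+s$ with $r\ge0,s\ge1$, $\boldsymbol a\in(-1,\infty)^q$, $\boldsymbol b\in(-1,\infty)^r$, $a_h<b_h$ ($1\le h\le r$), $\boldsymbol\beta\in\mathbb R^p$ with $\beta_i+a_j>-1$ for all $i,j$. Laguerre vector of the first kind: $w_0^{\mathrm L}=\mathcal B_{a_1,b_1}*\cdots*\mathcal B_{a_r,b_r}*\mathcal G_{a_{r+1}}*\cdots*\mathcal G_{a_q}$; $w_h^{\mathrm L}$ is $w_0^{\mathrm L}$ with $b_h$ replaced by $b_h+1$ ($1\le h\le r$); $v_\ell^{\mathrm L}=(-x\,\mathrm d/\mathrm dx)^{\ell-1}w_0^{\mathrm L}$ ($1\le\ell\le s$); $\mathbf U^{\mathrm L}=(w_1^{\mathrm L},\dots,w_r^{\mathrm L},v_1^{\mathrm L},\dots,v_s^{\mathrm L})$. Jacobi vector: for lower parameters $\boldsymbol b^{\mathrm J}=(b_1^{\mathrm J},\dots,b_q^{\mathrm J})$, $w_j^{\mathrm J}(x;\boldsymbol a,\boldsymbol b^{\mathrm J})$ is $\mathcal B_{a_1,b_1^{\mathrm J}}*\cdots*\mathcal B_{a_q,b_q^{\mathrm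 J}}$ with $b_j^{\mathrm J}$ replaced by $b_j^{\mathrm J}+1$. Fix pairwise distinct $\omega_1,\dots,\omega_s>0$ and, for large $t$, put $\boldsymbol b^{\mathrm J}(t)=(b_1,\dots,b_r,t\omega_1,\dots,t\omega_s)$, $\kappa_\ell(t)=t\omega_\ell-a_{r+\ell}-1$, $c_t=\prod_\ell\kappa_\ell(t)$, $d_t=\prod_\ell\kappa_\ell(t)^{a_{r+\ell}}\Gamma(\kappa_\ell(t)+1)$, $\varepsilon_\ell(t)=(t\omega_\ell)^{-1}$. Put $W_h^{(t)}(x)=d_tw_h^{\mathrm J}(x/c_t;\boldsymbol a,\boldsymbol b^{\mathrm J}(t))$ ($1\le h\le r$), $Z_\ell^{(t)}(x)=d_tw_{r+\ell}^{\mathrm J}(x/c_t;\boldsymbol a,\boldsymbol b^{\mathrm J}(t))$ ($1\le\ell\le s$), and $$\widehat V_k^{(t)}=\sum_{\ell=1}^kR_{k,\ell}^{(t)}Z_\ell^{(t)},\qquad R_{k,\ell}^{(t)}=\frac{(-1)^{k-1}}{\varepsilon_\ell(t)\prod_{1\le h\le k,\,h\ne\ell}(\varepsilon_\ell(t)-\varepsilon_h(t))}\quad(1\le\ell\le k\le s).$$ The transformed vector is $\widehat{\mathbf U}^{(t)}=(W_1^{(t)},\dots,W_r^{(t)},\widehat V_1^{(t)},\dots,\widehat V_s^{(t)})$. Step-line moment matrices. For $N\ge0$ and $d\ge1$ write $N=d\rho_d(N)+\ell_d(N)$, $0\le\ell_d(N)<d$. For a row vector $\mathbf U=(U_1,\dots,U_q)$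 on an interval $I$ and columns $V_i=x^{\beta_i}$, put $\mathscr U_N(x)=x^{\rho_q(N)}U_{\ell_q(N)+1}(x)$, $\mathscr V_M(x)=x^{\rho_p(M)}V_{\ell_p(M)+1}(x)$, $\mathscr M_{N,M}=\int_I\mathscr U_N\mathscr V_M\,\mathrm dx$, $N,M\ge0$. $\Lambda$ is the unilateral shift, $\Lambda_{N,M}=\delta_{N+1,M}$. A leading minor of order $n$ is the determinant of the submatrix with indices $0,\dots,n-1$ on both sides. Gauss–Borel objects (understood through finite leading submatrices, where the required leading minors are nonzero). $\mathscr M=S^{-1}H\widetilde S^{-\mathsf T}$ with $S,\widetilde S$ lower unitriangular, $H$ diagonal nonsingular. Forms: $\mathsf B_N=\sum_{M\le N}S_{N,M}\mathscr U_M$, $\mathsf A_N=H_{N,N}^{-1}\sum_{M\le N}\widetilde S_{N,M}\mathscr V_M$; thus the coefficient of $\mathscr U_N$ in $\mathsf B_N$ is one and $\int_I\mathsf A_N\mathsf B_M\,\mathrm dx=\delta_{N,M}$. Recurrence matrix: $T=S\Lambda^qS^{-1}$ (so $x\mathsf B=T\mathsf B$, $x\mathsf A=T^{\mathsf T}\mathsf A$; $T_{N,M}=0$ unless $N-p\le M\le N+q$, and $T_{N,N+q}=1$). Christoffel chains and bidiagonal factors. The row and column Christoffel chains are, respectively, the successive Gauss–Borel factorizations of $\Lambda^a\mathscr M$, $0\le a\le q$, and of $\mathscr M(\Lambda^b)^{\mathsf T}$, $0\le b\le p$; only finite portions of them are used. Let $S_a$ and $S^{(b)}$ be the unit lower triangular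 left factors in $\Lambda^a\mathscr M=S_a^{-1}H_a\widetilde S_a^{-\mathsf T}$ and $\mathscr M(\Lambda^b)^{\mathsf T}=(S^{(b)})^{-1}H^{(b)}(\widetilde S^{(b)})^{-\mathsf T}$. Then $U_a=S_a\Lambda S_{a-1}^{-1}$ ($1\le a\le q$, upper bidiagonal with unit first superdiagonal), $L_b=S^{(b-1)}(S^{(b)})^{-1}$ ($1\le b\le p$, lower bidiagonal with unit main diagonal), and $T=L_1\cdots L_p\,U_q\cdots U_1$. On every fixed truncation, the entries of these factors and of $T$ are rational functions of finitely many leading minors in the two chains. The leading minors "used up to level $K$" are those finitely many leading minors of the listed matrices that enter these finite portions of the chains when determining the forms, recurrence coefficients and bidiagonal-factor entries at indices not exceeding $K$. Hats denote the objects for $\widehat{\mathbf U}^{(t)}$ on $(0,c_t)$, superscript $\mathrm L$ those for $\mathbf U^{\mathrm L}$ on $(0,\infty)$. *)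

theory Defs
  imports
    "HOL-Analysis.Analysis"
    "HOL-Library.Groups_Big_Fun"
    "Jordan_Normal_Form.Gauss_Jordan_Elimination"
    "Jordan_Normal_Form.Determinant"
begin

text \<open>All parameter tuples, vectors of weights and columns are functions on \<^typ>\<open>nat\<close> of which only
  the values at the one-based indices of the text are used; e.g. \<open>a j\<close> for \<open>j \<in> {1..q}\<close>.
  Rows and columns of matrices are numbered from zero.\<close>

section \<open>Weights\<close>

definition beta_weight :: "real \<Rightarrow> real \<Rightarrow> real \<Rightarrow> real" where
  "beta_weight a b x =
     x powr a * (1 - x) powr (b - a - 1) / Gamma (b - a) * indicator {0<..<1} x"

definition gamma_weight :: "real \<Rightarrow> real \<Rightarrow> real" where
  "gamma_weight a x = x powr a * exp (- x) * indicator {0<..} x"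

definition mellin_conv :: "(real \<Rightarrow> real) \<Rightarrow> (real \<Rightarrow> real) \<Rightarrow> real \<Rightarrow> real" where
  "mellin_conv f g x = (LBINT u:{0<..}. f u * g (x / u) / u)"

text \<open>Iterated convolution of a nonempty list, bracketed to the left.\<close>

definition mellin_convs :: "(real \<Rightarrow> real) list \<Rightarrow> real \<Rightarrow> real" where
  "mellin_convs fs = foldl mellin_conv (hd fs) (tl fs)"


section \<open>Laguerre vector of the first kind\<close>

definition laguerre_w0 :: "nat \<Rightarrow> nat \<Rightarrow> (nat \<Rightarrow> real) \<Rightarrow> (nat \<Rightarrow> real) \<Rightarrow> real \<Rightarrow> real" where
  "laguerre_w0 r s a b =
     mellin_convs (map (\<lambda>h. beta_weight (a h) (b h)) [1..<r + 1] @
                   map (\<lambda>j. gamma_weight (a j)) [r + 1..<r + s + 1])"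

definition laguerre_w ::
    "nat \<Rightarrow> nat \<Rightarrow> (nat \<Rightarrow> real) \<Rightarrow> (nat \<Rightarrow> real) \<Rightarrow> nat \<Rightarrow> real \<Rightarrow> real" where
  "laguerre_w r s a b h = laguerre_w0 r s a (b(h := b h + 1))"

definition laguerre_v ::
    "nat \<Rightarrow> nat \<Rightarrow> (nat \<Rightarrow> real) \<Rightarrow> (nat \<Rightarrow> real) \<Rightarrow> nat \<Rightarrow> real \<Rightarrow> real" where
  "laguerre_v r s a b l = ((\<lambda>f x. - x * deriv f x) ^^ (l - 1)) (laguerre_w0 r s a b)"

definition laguerre_vec ::
    "nat \<Rightarrow> nat \<Rightarrow> (nat \<Rightarrow> real) \<Rightarrow> (nat \<Rightarrow> real) \<Rightarrow> nat \<Rightarrow> real \<Rightarrow> real" where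
  "laguerre_vec r s a b j =
     (if j \<le> r then laguerre_w r s a b j else laguerre_v r s a b (j - r))"


section \<open>Transformed Jacobi vector\<close>

definition jacobi_w ::
    "nat \<Rightarrow> (nat \<Rightarrow> real) \<Rightarrow> (nat \<Rightarrow> real) \<Rightarrow> nat \<Rightarrow> real \<Rightarrow> real" where
  "jacobi_w q a b j =
     mellin_convs (map (\<lambda>i. beta_weight (a i) ((b(j := b j + 1)) i)) [1..<q + 1])"

definition jacobi_b :: "nat \<Rightarrow> (nat \<Rightarrow> real) \<Rightarrow> (nat \<Rightarrow> real) \<Rightarrow> real \<Rightarrow> nat \<Rightarrow> real" where
  "jacobi_b r b \<omega> t j = (if j \<le> r then b j else t * \<omega> (j - r))"

definition kappa :: "nat \<Rightarrow> (nat \<Rightarrow> real) \<Rightarrow> (nat \<Rightarrow> real) \<Rightarrow> real \<Rightarrow> nat \<Rightarrow> real" where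
  "kappa r a \<omega> t l = t * \<omega> l - a (r + l) - 1"

definition c_scale :: "nat \<Rightarrow> nat \<Rightarrow> (nat \<Rightarrow> real) \<Rightarrow> (nat \<Rightarrow> real) \<Rightarrow> real \<Rightarrow> real" where
  "c_scale r s a \<omega> t = (\<Prod>l = 1..s. kappa r a \<omega> t l)"

definition d_scale :: "nat \<Rightarrow> nat \<Rightarrow> (nat \<Rightarrow> real) \<Rightarrow> (nat \<Rightarrow> real) \<Rightarrow> real \<Rightarrow> real" where
  "d_scale r s a \<omega> t =
     (\<Prod>l = 1..s. kappa r a \<omega> t l powr a (r + l) * Gamma (kappa r a \<omega> t l + 1))"

definition eps :: "(nat \<Rightarrow> real) \<Rightarrow> real \<Rightarrow> nat \<Rightarrow> real" where
  "eps \<omega> t l = inverse (t * \<omega> l)"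

text \<open>\<open>scaled_jacobi \<dots> t j\<close> is $W_j^{(t)}$ for \<open>j \<le> r\<close> and $Z_{j-r}^{(t)}$ for \<open>j > r\<close>.\<close>

definition scaled_jacobi ::
    "nat \<Rightarrow> nat \<Rightarrow> (nat \<Rightarrow> real) \<Rightarrow> (nat \<Rightarrow> real) \<Rightarrow> (nat \<Rightarrow> real) \<Rightarrow> real \<Rightarrow> nat \<Rightarrow> real \<Rightarrow> real" where
  "scaled_jacobi r s a b \<omega> t j x =
     d_scale r s a \<omega> t * jacobi_w (r + s) a (jacobi_b r b \<omega> t) j (x / c_scale r s a \<omega> t)"

definition R_coeff :: "(nat \<Rightarrow> real) \<Rightarrow> real \<Rightarrow> nat \<Rightarrow> nat \<Rightarrow> real" where
  "R_coeff \<omega> t k l =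
     (- 1) ^ (k - 1) / (eps \<omega> t l * (\<Prod>h \<in> {1..k} - {l}. eps \<omega> t l - eps \<omega> t h))"

definition V_hat ::
    "nat \<Rightarrow> nat \<Rightarrow> (nat \<Rightarrow> real) \<Rightarrow> (nat \<Rightarrow> real) \<Rightarrow> (nat \<Rightarrow> real) \<Rightarrow> real \<Rightarrow> nat \<Rightarrow> real \<Rightarrow> real" where
  "V_hat r s a b \<omega> t k x =
     (\<Sum>l = 1..k. R_coeff \<omega> t k l * scaled_jacobi r s a b \<omega> t (r + l) x)"

definition U_hat ::
    "nat \<Rightarrow> nat \<Rightarrow> (nat \<Rightarrow> real) \<Rightarrow> (nat \<Rightarrow> real) \<Rightarrow> (nat \<Rightarrow> real) \<Rightarrow> real \<Rightarrow> nat \<Rightarrow> real \<Rightarrow> real" where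
  "U_hat r s a b \<omega> t j =
     (if j \<le> r then scaled_jacobi r s a b \<omega> t j else V_hat r s a b \<omega> t (j - r))"


section \<open>Step-line moment matrices\<close>

type_synonym imat = "nat \<Rightarrow> nat \<Rightarrow> real"

definition step_line :: "nat \<Rightarrow> (nat \<Rightarrow> real \<Rightarrow> real) \<Rightarrow> nat \<Rightarrow> real \<Rightarrow> real" where
  "step_line d U N x = x ^ (N div d) * U (N mod d + 1) x"

definition moment_matrix ::
    "real set \<Rightarrow> nat \<Rightarrow> nat \<Rightarrow> (nat \<Rightarrow> real \<Rightarrow> real) \<Rightarrow> (nat \<Rightarrow> real) \<Rightarrow> imat" where
  "moment_matrix I p q U \<beta> N M =
     (LBINT x:I. step_line q U N x * step_line p (\<lambda>i x. x powr \<beta> i) M x)"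

definition laguerre_moments ::
    "nat \<Rightarrow> nat \<Rightarrow> nat \<Rightarrow> (nat \<Rightarrow> real) \<Rightarrow> (nat \<Rightarrow> real) \<Rightarrow> (nat \<Rightarrow> real) \<Rightarrow> imat" where
  "laguerre_moments p r s a b \<beta> =
     moment_matrix {0<..} p (r + s) (laguerre_vec r s a b) \<beta>"

definition jacobi_moments ::
    "nat \<Rightarrow> nat \<Rightarrow> nat \<Rightarrow> (nat \<Rightarrow> real) \<Rightarrow> (nat \<Rightarrow> real) \<Rightarrow> (nat \<Rightarrow> real) \<Rightarrow> (nat \<Rightarrow> real) \<Rightarrow>
     real \<Rightarrow> imat" where
  "jacobi_moments p r s a b \<beta> \<omega> t =
     moment_matrix {0<..<c_scale r s a \<omega> t} p (r + s) (U_hat r s a b \<omega> t) \<beta>"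


section \<open>Semi-infinite matrices\<close>

text \<open>Every product below has only finitely many nonzero terms in each entry, which is when
  \<^const>\<open>Sum_any\<close> is the sum.\<close>

definition imat_mult :: "imat \<Rightarrow> imat \<Rightarrow> imat" (infixl "\<odot>" 70) where
  "(X \<odot> Y) N M = Sum_any (\<lambda>k. X N k * Y k M)"

definition imat_transpose :: "imat \<Rightarrow> imat" where
  "imat_transpose X N M = X M N"

definition shift :: imat where
  "shift N M = (if M = N + 1 then 1 else 0)"

primrec shift_pow :: "nat \<Rightarrow> imat" where
  "shift_pow 0 = (\<lambda>N M. if M = N then 1 else 0)"
| "shift_pow (Suc n) = shift \<odot> shift_pow n"

definition leading :: "nat \<Rightarrow> imat \<Rightarrow> real mat" where
  "leading n X = Matrix.mat n n (\<lambda>(i, j). X i j)"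

definition leading_minor :: "imat \<Rightarrow> nat \<Rightarrow> real" where
  "leading_minor X n = Determinant.det (leading n X)"

definition matrix_inverse :: "real mat \<Rightarrow> real mat" where
  "matrix_inverse X = the (mat_inverse X)"

text \<open>The inverse of a semi-infinite lower unitriangular matrix: its leading submatrices are the
  inverses of those of \<open>X\<close>.  Its row \<open>N\<close> is defined by the rows \<open>0, \<dots>, N\<close> of \<open>X\<close> alone.\<close>

definition lower_inverse :: "imat \<Rightarrow> imat" where
  "lower_inverse X N M = (if M \<le> N then matrix_inverse (leading (N + 1) X) $$ (N, M) else 0)"


section \<open>Gauss-Borel factorization\<close>

definition unit_lower_triangular :: "real mat \<Rightarrow> bool" where
  "unit_lower_triangular X \<longleftrightarrow>
     (\<forall>i < dim_row X. X $$ (i, i) = 1 \<and> (\<forall>j < dim_col X. i < j \<longrightarrow> X $$ (i, j) = 0))"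

text \<open>The factorization $X = S^{-1} H \widetilde S^{-T}$ of the leading submatrix of order \<open>n\<close>.
  The last pivot of \<open>H\<close> is left free: the factors exist and are unique as soon as the leading minors
  of orders \<open>1, \<dots>, n - 1\<close> are nonzero, so that row \<open>N\<close> of \<open>S\<close> needs the minors of orders \<open>1, \<dots>, N\<close>
  only.  The last pivot is nonzero iff the minor of order \<open>n\<close> is nonzero, too.\<close>

definition gauss_borel :: "nat \<Rightarrow> imat \<Rightarrow> real mat \<times> real mat \<times> real mat \<Rightarrow> bool" where
  "gauss_borel n X = (\<lambda>(S, H, St).
     S \<in> carrier_mat n n \<and> H \<in> carrier_mat n n \<and> St \<in> carrier_mat n n \<and>
     unit_lower_triangular S \<and> unit_lower_triangular St \<and>
     diagonal_mat H \<and> (\<forall>i. i + 1 < n \<longrightarrow> H $$ (i, i) \<noteq> 0) \<and>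
     leading n X = matrix_inverse S * H * transpose_mat (matrix_inverse St))"

definition gb_factors :: "nat \<Rightarrow> imat \<Rightarrow> real mat \<times> real mat \<times> real mat" where
  "gb_factors n X = (THE F. gauss_borel n X F)"

text \<open>The factors of leading submatrices of different orders are compatible; row \<open>N\<close> is read off
  from the smallest one that contains it.\<close>

definition gb_S :: "imat \<Rightarrow> imat" where
  "gb_S X N M = (if M \<le> N then fst (gb_factors (N + 1) X) $$ (N, M) else 0)"

definition gb_H :: "imat \<Rightarrow> nat \<Rightarrow> real" where
  "gb_H X N = fst (snd (gb_factors (N + 1) X)) $$ (N, N)"

definition gb_St :: "imat \<Rightarrow> imat" where
  "gb_St X N M = (if M \<le> N then snd (snd (gb_factors (N + 1) X)) $$ (N, M) else 0)"

text \<open>\<open>B_coeff X N M\<close> and \<open>A_coeff X N M\<close> are the coefficients of $\mathscr U_M$ in the form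
  $\mathsf B_N$ and of $\mathscr V_M$ in the form $\mathsf A_N$.\<close>

definition B_coeff :: "imat \<Rightarrow> imat" where
  "B_coeff X N M = gb_S X N M"

definition A_coeff :: "imat \<Rightarrow> imat" where
  "A_coeff X N M = inverse (gb_H X N) * gb_St X N M"

definition recurrence_matrix :: "nat \<Rightarrow> imat \<Rightarrow> imat" where
  "recurrence_matrix q X = gb_S X \<odot> shift_pow q \<odot> lower_inverse (gb_S X)"


section \<open>Christoffel chains\<close>

definition row_chain :: "nat \<Rightarrow> imat \<Rightarrow> imat" where
  "row_chain k X = shift_pow k \<odot> X"

definition column_chain :: "nat \<Rightarrow> imat \<Rightarrow> imat" where
  "column_chain k X = X \<odot> imat_transpose (shift_pow k)"

definition upper_factor :: "imat \<Rightarrow> nat \<Rightarrow> imat" where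
  "upper_factor X k = gb_S (row_chain k X) \<odot> shift \<odot> lower_inverse (gb_S (row_chain (k - 1) X))"

definition lower_factor :: "imat \<Rightarrow> nat \<Rightarrow> imat" where
  "lower_factor X k =
     gb_S (column_chain (k - 1) X) \<odot> lower_inverse (gb_S (column_chain k X))"

text \<open>Nonvanishing of the leading minors used up to level \<open>K\<close>.  Row \<open>K\<close> of
  $T = S \Lambda^q S^{-1}$ involves the rows of \<open>S\<close> up to \<open>K + q\<close>, hence the minors of $\mathscr M$ up
  to order \<open>K + q\<close> (and \<open>K + q \<ge> K + 1\<close> also covers $H_{K,K}$ in $\mathsf A_K$).  Write $D^{[k]}_n$
  and $D^{(k)}_n$ for the minors of order \<open>n\<close> in the row and the column chain.  The nontrivial entries
  of the bidiagonal factors are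
  $(U_k)_{N,N} = D^{[k]}_{N+1} D^{[k-1]}_N / (D^{[k]}_N D^{[k-1]}_{N+1})$ and
  $(L_k)_{N,N-1} = D^{(k-1)}_{N+1} D^{(k)}_{N-1} / (D^{(k-1)}_N D^{(k)}_N)$; with \<open>N \<le> K\<close> they involve
  orders up to \<open>K + 1\<close>, except that only orders up to \<open>K\<close> enter from the last matrix, \<open>k = p\<close>, of the
  column chain.\<close>

definition used_minors_nonzero :: "nat \<Rightarrow> nat \<Rightarrow> nat \<Rightarrow> imat \<Rightarrow> bool" where
  "used_minors_nonzero p q K X \<longleftrightarrow>
     (\<forall>n \<in> {1..K + q}. leading_minor X n \<noteq> 0) \<and>
     (\<forall>k \<in> {1..q}. \<forall>n \<in> {1..K + 1}. leading_minor (row_chain k X) n \<noteq> 0) \<and>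
     (\<forall>k \<in> {1..p}. \<forall>n \<in> {1..if k < p then K + 1 else K}. leading_minor (column_chain k X) n \<noteq> 0)"

end

theory Submission
  imports Defs
begin

text \<open>
  All objects of the statement are, entry by entry, rational functions of finitely many entries of the
  moment matrix: row \<open>N\<close> of the left Gauss-Borel factor consists of the cofactors of the last column of
  the leading submatrix of order \<open>N + 1\<close>, divided by the minor of order \<open>N\<close>.  So everything follows from
  the entrywise convergence of the moment matrices.

  The power moments of a Mellin convolution are the products of the power moments, hence all moments
  in question are explicit products of Gamma functions.  With $z = m + 1$, the $m$-th moments of
  $W_h^{(t)}$ and $Z_\ell^{(t)}$ are the one of $w_0^{\mathrm L}$ times $1/(z + b_h)$ and
  $1/(z + t\omega_\ell)$, respectively, up to a factor which tends to one by
  $\kappa^y \Gamma(\kappa + 1)/\Gamma(\kappa + 1 + y) \to 1$.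
  The coefficients $R_{k,\ell}^{(t)}$ take a divided difference of $\varepsilon \mapsto 1/(1 + z\varepsilon)$,
  with the value $z^{k-1}/\prod_h (1 + z\varepsilon_h) \to z^{k-1}$, and
  $z^{k-1}$ is also the factor produced by $(-x\,\mathrm d/\mathrm dx)^{k-1}$ on the Laguerre side.
\<close>

section \<open>Gauss-Borel factors in terms of cofactors\<close>

text \<open>The factors are given by a definite description and inverses by a partial function, so
  the cofactor formula has to be shown to yield the only factorization. For the approximating
  matrices it holds only once their minors are nonzero, so limits are computed for the formula and
  transferred through an equality that holds eventually. The derivatives in the Laguerre vector are
  genuine derivatives of an integral. Integrating by parts in the moments would require control of
  boundary terms at zero and infinity. Instead the last Gamma weight of the convolution carries all
  derivatives, and the result is expanded into convolutions with Gamma weights of raised parameter,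
  whose moments are already known. The analysis is thereby reduced to one differentiation under the
  integral sign. The number \<open>z = m + 1\<close> may be negative, so the positivity of
  \<open>z + t * \<omega> l\<close> is drawn from the parameter conditions, not from the sign of
  \<open>z\<close>.\<close>

lemma matrix_inverse_eqI:
  assumes A: "A \<in> carrier_mat n n" and B: "B \<in> carrier_mat n n" and AB: "A * B = 1\<^sub>m n"
  shows "matrix_inverse A = B"
proof -
  have BA: "B * A = 1\<^sub>m n" using mat_mult_left_right_inverse[OF A B AB] .
  show ?thesis
  proof (cases "mat_inverse A")
    case None
    from mat_inverse(1)[OF A None, of "()"] have "A \<notin> Units (ring_mat TYPE(real) n ())" .
    moreover have "A \<in> Units (ring_mat TYPE(real) n ())"
      using A B AB BA by (auto simp: Units_def ring_mat_def)
    ultimately show ?thesis by simp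
  next
    case (Some C)
    from mat_inverse(2)[OF A Some] have C: "C \<in> carrier_mat n n" "C * A = 1\<^sub>m n" by auto
    have "C = C * (A * B)" using C AB by simp
    also have "\<dots> = B" using C A B by (metis assoc_mult_mat left_mult_one_mat)
    finally show ?thesis using Some by (simp add: matrix_inverse_def)
  qed
qed

lemma det_unit_lower_triangular:
  assumes "A \<in> carrier_mat n n" "unit_lower_triangular A"
  shows "Determinant.det A = 1"
proof -
  have "Determinant.det A = prod_list (diag_mat A)"
    by (rule det_lower_triangular[OF _ assms(1)]) (use assms in \<open>auto simp: unit_lower_triangular_def\<close>)
  also have "diag_mat A = map (\<lambda>i. 1) [0..<n]"
    using assms by (auto simp: diag_mat_def unit_lower_triangular_def)
  finally show ?thesis by (simp add: map_replicate_const)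
qed

text \<open>The determinant is one, so the inverse is the adjugate: its entries are polynomials in
  those of \<open>A\<close>, and taking limits involves no division.\<close>

lemma unit_lower_triangular_inverse:
  assumes A: "A \<in> carrier_mat n n" and U: "unit_lower_triangular A"
  shows "matrix_inverse A = adj_mat A" "matrix_inverse A \<in> carrier_mat n n"
    "A * matrix_inverse A = 1\<^sub>m n" "matrix_inverse A * A = 1\<^sub>m n"
proof -
  have d: "Determinant.det A = 1" by (rule det_unit_lower_triangular[OF A U])
  have AB: "A * adj_mat A = 1\<^sub>m n" "adj_mat A * A = 1\<^sub>m n" and B: "adj_mat A \<in> carrier_mat n n"
    using adj_mat[OF A] d by auto
  show *: "matrix_inverse A = adj_mat A" by (rule matrix_inverse_eqI[OF A B AB(1)])
  show "matrix_inverse A \<in> carrier_mat n n" "A * matrix_inverse A = 1\<^sub>m n"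
    "matrix_inverse A * A = 1\<^sub>m n" using * AB B by auto
qed

lemma index_mult_mat_sum:
  assumes "A \<in> carrier_mat n k" "B \<in> carrier_mat k m" "i < n" "j < m"
  shows "(A * B) $$ (i, j) = (\<Sum>l<k. A $$ (i, l) * B $$ (l, j))"
  using assms by (auto simp: scalar_prod_def atLeast0LessThan)

lemma unit_lower_triangular_matrix_inverse:
  assumes A: "A \<in> carrier_mat n n" and U: "unit_lower_triangular A"
  shows "unit_lower_triangular (matrix_inverse A)"
proof -
  let ?B = "matrix_inverse A"
  note B = unit_lower_triangular_inverse(2,3)[OF A U]
  \<comment> \<open>Forward substitution: once the earlier rows of the inverse are known to vanish
    right of the diagonal, row \<open>i\<close> of \<open>A * ?B = 1\<close> reduces to a single
    term for \<open>i \<le> j\<close>.\<close>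
  have key: "\<forall>j<n. i \<le> j \<longrightarrow> ?B $$ (i, j) = (if i = j then 1 else 0)" if "i < n" for i
    using that
  proof (induction i rule: less_induct)
    case (less i)
    show ?case
    proof (intro allI impI)
      fix j assume j: "j < n" "i \<le> j"
      have "(if i = j then 1 else 0) = (A * ?B) $$ (i, j)" using B j less by auto
      also have "\<dots> = (\<Sum>l<n. A $$ (i, l) * ?B $$ (l, j))"
        by (rule index_mult_mat_sum) (use A B less j in auto)
      also have "\<dots> = (\<Sum>l\<in>{i}. A $$ (i, l) * ?B $$ (l, j))"
      proof (rule sum.mono_neutral_right)
        show "\<forall>l\<in>{..<n} - {i}. A $$ (i, l) * ?B $$ (l, j) = 0"
        proof
          fix l assume l: "l \<in> {..<n} - {i}"
          show "A $$ (i, l) * ?B $$ (l, j) = 0"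
          proof (cases "l < i")
            case True then show ?thesis using less j l by auto
          next
            case False
            then have "i < l" using l by auto
            then show ?thesis using U A less l by (auto simp: unit_lower_triangular_def)
          qed
        qed
      qed (use less in auto)
      also have "\<dots> = ?B $$ (i, j)" using U A less by (auto simp: unit_lower_triangular_def)
      finally show "?B $$ (i, j) = (if i = j then 1 else 0)" ..
    qed
  qed
  then show ?thesis using B(1) by (auto simp: unit_lower_triangular_def)
qed

section \<open>Leading submatrices and rows of cofactors\<close>

lemma leading_carrier [simp]: "leading n X \<in> carrier_mat n n"
  by (simp add: leading_def)

lemma leading_dim [simp]: "dim_row (leading n X) = n" "dim_col (leading n X) = n"
  by (simp_all add: leading_def)

lemma leading_index [simp]: "i < n \<Longrightarrow> j < n \<Longrightarrow> leading n X $$ (i, j) = X i j"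
  by (simp add: leading_def)

lemma leading_transpose: "leading n (imat_transpose X) = transpose_mat (leading n X)"
  by (rule eq_matI) (auto simp: imat_transpose_def)

lemma leading_minor_0 [simp]: "leading_minor X 0 = 1"
  by (simp add: leading_minor_def leading_def)

lemma leading_minor_transpose [simp]: "leading_minor (imat_transpose X) n = leading_minor X n"
  by (simp add: leading_minor_def leading_transpose det_transpose[OF leading_carrier])

definition gb_coeff :: "imat \<Rightarrow> imat" where
  "gb_coeff X N M =
     (if M \<le> N then cofactor (leading (N + 1) X) M N / leading_minor X N else 0)"

lemma gb_coeff_diag: "leading_minor X N \<noteq> 0 \<Longrightarrow> gb_coeff X N N = 1"
proof -
  have "mat_delete (leading (N + 1) X) N N = leading N X"
    by (rule eq_matI) (auto simp: mat_delete_def leading_def)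
  then show "leading_minor X N \<noteq> 0 \<Longrightarrow> gb_coeff X N N = 1"
    by (simp add: gb_coeff_def cofactor_def leading_minor_def)
qed

text \<open>Up to the division, the sum is an entry in the last row of adjugate times matrix, so
  Laplace expansion gives the determinant or zero.\<close>

lemma gb_coeff_orthogonal:
  assumes "j \<le> N"
  shows "(\<Sum>k\<le>N. gb_coeff X N k * X k j) =
    (if j = N then leading_minor X (N + 1) / leading_minor X N else 0)"
proof -
  let ?A = "leading (N + 1) X"
  have "(adj_mat ?A * ?A) $$ (N, j) = (\<Sum>k<N+1. adj_mat ?A $$ (N, k) * ?A $$ (k, j))"
    by (rule index_mult_mat_sum) (use assms adj_mat[of ?A "N+1"] in auto)
  also have "\<dots> = (\<Sum>k\<le>N. cofactor ?A k N * X k j)"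
    using assms by (intro sum.cong) (auto simp: adj_mat_def)
  finally have "(\<Sum>k\<le>N. cofactor ?A k N * X k j) = (if j = N then leading_minor X (N + 1) else 0)"
    using adj_mat(3)[of ?A "N+1"] assms by (auto simp: leading_minor_def)
  moreover have "(\<Sum>k\<le>N. gb_coeff X N k * X k j) = (\<Sum>k\<le>N. cofactor ?A k N * X k j) / leading_minor X N"
    by (simp add: gb_coeff_def sum_divide_distrib)
  ultimately show ?thesis by simp
qed

text \<open>Two candidates differ by a row that ends in zero and annihilates the leading submatrix
  of order \<open>N\<close> from the left; that submatrix is nonsingular.\<close>

lemma gb_coeff_unique:
  assumes nz: "leading_minor X N \<noteq> 0"
    and orth: "\<And>j. j < N \<Longrightarrow> (\<Sum>k\<le>N. s k * X k j) = 0" and one: "s N = 1" and "k \<le> N"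
  shows "s k = gb_coeff X N k"
proof -
  define d where "d k = s k - gb_coeff X N k" for k
  have dN: "d N = 0" using one gb_coeff_diag[OF nz] by (simp add: d_def)
  have dorth: "(\<Sum>k<N. d k * X k j) = 0" if "j < N" for j
  proof -
    have "(\<Sum>k\<le>N. d k * X k j) = (\<Sum>k\<le>N. s k * X k j) - (\<Sum>k\<le>N. gb_coeff X N k * X k j)"
      by (simp add: d_def left_diff_distrib sum_subtractf)
    also have "\<dots> = 0" using orth[OF that] gb_coeff_orthogonal[of j N X] that by simp
    finally show ?thesis using dN by (simp add: lessThan_Suc_atMost[symmetric])
  qed
  have "transpose_mat (leading N X) *\<^sub>v vec N d = 0\<^sub>v N"
    by (rule eq_vecI) (use dorth in \<open>auto simp: scalar_prod_def atLeast0LessThan mult.commute\<close>)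
  moreover have "Determinant.det (transpose_mat (leading N X)) \<noteq> 0"
    using nz by (simp add: det_transpose[OF leading_carrier] leading_minor_def)
  ultimately have "vec N d = 0\<^sub>v N"
    using det_0_iff_vec_prod_zero[of "transpose_mat (leading N X)" N]
    by (metis leading_carrier transpose_carrier_mat vec_carrier)
  then have "d k = 0" if "k < N" for k using that by (metis index_vec index_zero_vec(1))
  then show ?thesis using dN \<open>k \<le> N\<close> by (cases "k = N") (auto simp: d_def)
qed

text \<open>Transposition exchanges the triangular factors, so uniqueness of the left factor also
  yields uniqueness of the right one.\<close>

lemma gauss_borel_transpose:
  assumes "gauss_borel n X (S, H, St)"
  shows "gauss_borel n (imat_transpose X) (St, H, S)"
proof -
  have c: "S \<in> carrier_mat n n" "H \<in> carrier_mat n n" "St \<in> carrier_mat n n"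
    and u: "unit_lower_triangular S" "unit_lower_triangular St" and dH: "diagonal_mat H"
    and eq: "leading n X = matrix_inverse S * H * transpose_mat (matrix_inverse St)"
    using assms by (auto simp: gauss_borel_def)
  note iS = unit_lower_triangular_inverse(2)[OF c(1) u(1)]
  note iSt = unit_lower_triangular_inverse(2)[OF c(3) u(2)]
  have "transpose_mat H = H" using dH c(2)
    by (intro eq_matI) (auto simp: diagonal_mat_def, metis)
  then have "leading n (imat_transpose X) = matrix_inverse St * H * transpose_mat (matrix_inverse S)"
    unfolding leading_transpose eq using iS iSt c
    by (simp add: transpose_mult[of _ n n _ n] assoc_mult_mat[of _ n n _ n _ n])
  then show ?thesis using assms by (auto simp: gauss_borel_def)
qed

text \<open>Multiplication by \<open>S\<close> leaves \<open>H\<close> times an upper unitriangular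
  matrix, so on and below the diagonal only the pivots survive. These are the relations that
  determine row \<open>i\<close> of \<open>S\<close>.\<close>

lemma gauss_borel_rows:
  assumes G: "gauss_borel n X (S, H, St)" and "i < n" "j < n" "j \<le> i"
  shows "(\<Sum>k\<le>i. S $$ (i, k) * X k j) = (if j = i then H $$ (i, i) else 0)"
proof -
  have c: "S \<in> carrier_mat n n" "H \<in> carrier_mat n n" "St \<in> carrier_mat n n"
    and u: "unit_lower_triangular S" "unit_lower_triangular St" and dH: "diagonal_mat H"
    and eq: "leading n X = matrix_inverse S * H * transpose_mat (matrix_inverse St)"
    using G by (auto simp: gauss_borel_def)
  let ?C = "matrix_inverse St"
  note iS = unit_lower_triangular_inverse[OF c(1) u(1)]
  note iSt = unit_lower_triangular_inverse(2)[OF c(3) u(2)]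
  note uC = unit_lower_triangular_matrix_inverse[OF c(3) u(2)]
  have "S * leading n X = (S * matrix_inverse S) * (H * transpose_mat ?C)"
    unfolding eq using iS(2) iSt c
    by (simp add: assoc_mult_mat[of _ n n _ n _ n])
  also have "\<dots> = H * transpose_mat ?C" using iS iSt c by simp
  finally have SX: "S * leading n X = H * transpose_mat ?C" .
  have "(S * leading n X) $$ (i, j) = (\<Sum>k<n. S $$ (i, k) * leading n X $$ (k, j))"
    by (rule index_mult_mat_sum) (use assms c in auto)
  also have "\<dots> = (\<Sum>k\<le>i. S $$ (i, k) * X k j)"
    by (rule sum.mono_neutral_cong_right) (use assms c u in \<open>auto simp: unit_lower_triangular_def\<close>)
  finally have 1: "(S * leading n X) $$ (i, j) = (\<Sum>k\<le>i. S $$ (i, k) * X k j)" .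
  have "(H * transpose_mat ?C) $$ (i, j) = (\<Sum>k<n. H $$ (i, k) * transpose_mat ?C $$ (k, j))"
    by (rule index_mult_mat_sum) (use assms c iSt in auto)
  also have "\<dots> = (\<Sum>k\<in>{i}. H $$ (i, k) * transpose_mat ?C $$ (k, j))"
    by (rule sum.mono_neutral_right) (use assms c dH in \<open>auto simp: diagonal_mat_def\<close>)
  also have "\<dots> = (if j = i then H $$ (i, i) else 0)"
    using iSt uC assms by (auto simp: unit_lower_triangular_def)
  finally show ?thesis using 1 SX by simp
qed

lemma gauss_borel_left_factor:
  assumes G: "gauss_borel n X (S, H, St)" and nz: "\<And>m. m < n \<Longrightarrow> leading_minor X m \<noteq> 0"
    and "i < n" "k < n"
  shows "S $$ (i, k) = gb_coeff X i k"
    and "H $$ (i, i) = leading_minor X (i + 1) / leading_minor X i"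
proof -
  have c: "S \<in> carrier_mat n n" and u: "unit_lower_triangular S"
    using G by (auto simp: gauss_borel_def)
  have *: "S $$ (i, k) = gb_coeff X i k" if "k \<le> i" for k
    by (rule gb_coeff_unique[OF nz[OF \<open>i < n\<close>] _ _ that])
      (use gauss_borel_rows[OF G] assms c u in \<open>auto simp: unit_lower_triangular_def\<close>)
  show "S $$ (i, k) = gb_coeff X i k"
    using * assms c u by (cases "k \<le> i") (auto simp: unit_lower_triangular_def gb_coeff_def)
  have "H $$ (i, i) = (\<Sum>k\<le>i. S $$ (i, k) * X k i)"
    using gauss_borel_rows[OF G, of i i] assms by simp
  also have "\<dots> = (\<Sum>k\<le>i. gb_coeff X i k * X k i)" using * by simp
  also have "\<dots> = leading_minor X (i + 1) / leading_minor X i" by (simp add: gb_coeff_orthogonal)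
  finally show "H $$ (i, i) = leading_minor X (i + 1) / leading_minor X i" .
qed

lemma gauss_borel_exists:
  assumes nz: "\<And>m. m < n \<Longrightarrow> leading_minor X m \<noteq> 0"
  shows "gauss_borel n X
    (leading n (gb_coeff X),
     Matrix.mat n n (\<lambda>(i, j). if i = j then leading_minor X (i + 1) / leading_minor X i else 0),
     leading n (gb_coeff (imat_transpose X)))"
proof -
  define S where "S = leading n (gb_coeff X)"
  define St where "St = leading n (gb_coeff (imat_transpose X))"
  define H where "H = Matrix.mat n n
    (\<lambda>(i, j). if i = j then leading_minor X (i + 1) / leading_minor X i else 0)"
  have c [simp]: "S \<in> carrier_mat n n" "H \<in> carrier_mat n n" "St \<in> carrier_mat n n"
    by (simp_all add: S_def St_def H_def)
  have u: "unit_lower_triangular S" "unit_lower_triangular St"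
    using nz by (auto simp: unit_lower_triangular_def S_def St_def gb_coeff_diag)
       (simp_all add: gb_coeff_def)
  have SX: "(\<Sum>k<n. S $$ (i, k) * X k j) =
      (if j = i then leading_minor X (i + 1) / leading_minor X i else 0)"
    if "i < n" "j \<le> i" for i j
  proof -
    have "(\<Sum>k<n. S $$ (i, k) * X k j) = (\<Sum>k\<le>i. gb_coeff X i k * X k j)"
      by (rule sum.mono_neutral_cong_right) (use that in \<open>auto simp: S_def gb_coeff_def\<close>)
    then show ?thesis using gb_coeff_orthogonal[OF that(2)] by simp
  qed
  have XS: "(\<Sum>k<n. X i k * St $$ (j, k)) = 0" if "j < n" "i < j" for i j
  proof -
    have "(\<Sum>k<n. X i k * St $$ (j, k)) =
        (\<Sum>k\<le>j. gb_coeff (imat_transpose X) j k * imat_transpose X k i)"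
      by (rule sum.mono_neutral_cong_right)
        (use that in \<open>auto simp: St_def gb_coeff_def imat_transpose_def\<close>)
    then show ?thesis using gb_coeff_orthogonal[of i j "imat_transpose X"] that by simp
  qed
  \<comment> \<open>Above the diagonal the entry vanishes because the rows of \<open>St\<close> are
    orthogonal to the earlier rows of \<open>X\<close>; elsewhere the orthogonality of the rows of
    \<open>S\<close> to the earlier columns decides.\<close>
  have SXS: "S * leading n X * transpose_mat St = H"
  proof (rule eq_matI)
    fix i j assume "i < dim_row H" "j < dim_col H"
    then have ij: "i < n" "j < n" by (auto simp: H_def)
    have e1: "(S * leading n X * transpose_mat St) $$ (i, j) =
        (\<Sum>l<n. (\<Sum>k<n. S $$ (i, k) * X k l) * St $$ (j, l))"
    proof -
      have "(S * leading n X * transpose_mat St) $$ (i, j) =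
        (\<Sum>l<n. (S * leading n X) $$ (i, l) * transpose_mat St $$ (l, j))"
        by (rule index_mult_mat_sum) (use ij in \<open>auto intro!: mult_carrier_mat\<close>)
      also have "\<dots> = (\<Sum>l<n. (\<Sum>k<n. S $$ (i, k) * X k l) * St $$ (j, l))"
      proof (rule sum.cong[OF refl])
        fix l assume l: "l \<in> {..<n}"
        have "(S * leading n X) $$ (i, l) = (\<Sum>k<n. S $$ (i, k) * leading n X $$ (k, l))"
          by (rule index_mult_mat_sum) (use ij l in auto)
        moreover have "transpose_mat St $$ (l, j) = St $$ (j, l)"
          using ij l c(3) by (metis carrier_matD index_transpose_mat(1) lessThan_iff)
        ultimately show "(S * leading n X) $$ (i, l) * transpose_mat St $$ (l, j) =
          (\<Sum>k<n. S $$ (i, k) * X k l) * St $$ (j, l)"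
          using l by simp
      qed
      finally show ?thesis .
    qed
    show "(S * leading n X * transpose_mat St) $$ (i, j) = H $$ (i, j)"
    proof (cases "i < j")
      case True
      have "(\<Sum>l<n. (\<Sum>k<n. S $$ (i, k) * X k l) * St $$ (j, l)) =
          (\<Sum>l<n. \<Sum>k<n. S $$ (i, k) * (X k l * St $$ (j, l)))"
        by (simp add: sum_distrib_right mult.assoc)
      also have "\<dots> = (\<Sum>k<n. S $$ (i, k) * (\<Sum>l<n. X k l * St $$ (j, l)))"
        by (subst sum.swap) (simp add: sum_distrib_left)
      also have "\<dots> = 0"
      proof (rule sum.neutral, rule ballI)
        fix k assume k: "k \<in> {..<n}"
        show "S $$ (i, k) * (\<Sum>l<n. X k l * St $$ (j, l)) = 0"
        proof (cases "k < j")
          case True then show ?thesis using XS ij by simp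
        next
          case False
          then show ?thesis using k ij True by (auto simp: S_def gb_coeff_def)
        qed
      qed
      finally show ?thesis using e1 ij True by (simp add: H_def)
    next
      case False
      have "(\<Sum>l<n. (\<Sum>k<n. S $$ (i, k) * X k l) * St $$ (j, l)) =
          (\<Sum>l\<in>{j}. (\<Sum>k<n. S $$ (i, k) * X k l) * St $$ (j, l))"
      proof (rule sum.mono_neutral_right)
        show "\<forall>l\<in>{..<n} - {j}. (\<Sum>k<n. S $$ (i, k) * X k l) * St $$ (j, l) = 0"
        proof
          fix l assume l: "l \<in> {..<n} - {j}"
          show "(\<Sum>k<n. S $$ (i, k) * X k l) * St $$ (j, l) = 0"
          proof (cases "l < j")
            case True
            then show ?thesis using SX[of i l] ij False by simp
          next
            case F: False
            then show ?thesis using l ij by (auto simp: St_def gb_coeff_def)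
          qed
        qed
      qed (use ij in auto)
      also have "\<dots> = (if i = j then leading_minor X (i + 1) / leading_minor X i else 0)"
        using SX[of i j] ij False u(2) c(3) by (auto simp: unit_lower_triangular_def)
      finally show ?thesis using e1 ij by (simp add: H_def)
    qed
  qed (auto simp: S_def St_def H_def)
  note iS = unit_lower_triangular_inverse[OF c(1) u(1)]
  note iSt = unit_lower_triangular_inverse[OF c(3) u(2)]
  have t: "transpose_mat St * transpose_mat (matrix_inverse St) = 1\<^sub>m n"
    using transpose_mult[OF iSt(2) c(3)] iSt(4) by simp
  have "matrix_inverse S * H * transpose_mat (matrix_inverse St) =
      (matrix_inverse S * S) * leading n X * (transpose_mat St * transpose_mat (matrix_inverse St))"
    unfolding SXS[symmetric] using iS(2) iSt(2)
    by (simp add: assoc_mult_mat[of _ n n _ n _ n] mult_carrier_mat[of _ n n _ n])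
  also have "\<dots> = leading n X" unfolding t iS(4) by simp
  finally have "leading n X = matrix_inverse S * H * transpose_mat (matrix_inverse St)" ..
  moreover have "diagonal_mat H" by (auto simp: diagonal_mat_def H_def)
  moreover have "\<forall>i. i + 1 < n \<longrightarrow> H $$ (i, i) \<noteq> 0" using nz by (auto simp: H_def)
  ultimately have "gauss_borel n X (S, H, St)" using u by (simp add: gauss_borel_def)
  then show ?thesis by (simp add: S_def H_def St_def)
qed

lemma gb_factors_eq:
  assumes nz: "\<And>m. m < n \<Longrightarrow> leading_minor X m \<noteq> 0"
  shows "gb_factors n X =
    (leading n (gb_coeff X),
     Matrix.mat n n (\<lambda>(i, j). if i = j then leading_minor X (i + 1) / leading_minor X i else 0),
     leading n (gb_coeff (imat_transpose X)))"
  unfolding gb_factors_def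
proof (rule the_equality[where a = "(_, _, _)"])
  show "gauss_borel n X
    (leading n (gb_coeff X),
     Matrix.mat n n (\<lambda>(i, j). if i = j then leading_minor X (i + 1) / leading_minor X i else 0),
     leading n (gb_coeff (imat_transpose X)))" by (rule gauss_borel_exists[OF nz])
next
  fix F assume F: "gauss_borel n X F"
  obtain S H St where [simp]: "F = (S, H, St)" by (cases F)
  have G: "gauss_borel n X (S, H, St)" using F by simp
  have Gt: "gauss_borel n (imat_transpose X) (St, H, S)" by (rule gauss_borel_transpose[OF G])
  have c: "S \<in> carrier_mat n n" "H \<in> carrier_mat n n" "St \<in> carrier_mat n n"
    and dH: "diagonal_mat H" using G by (auto simp: gauss_borel_def)
  have "S = leading n (gb_coeff X)"
    by (rule eq_matI) (use c gauss_borel_left_factor(1)[OF G nz] in auto)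
  moreover have "St = leading n (gb_coeff (imat_transpose X))"
    by (rule eq_matI) (use c gauss_borel_left_factor(1)[OF Gt] nz in auto)
  moreover have "H = Matrix.mat n n
      (\<lambda>(i, j). if i = j then leading_minor X (i + 1) / leading_minor X i else 0)"
    by (rule eq_matI) (use c dH gauss_borel_left_factor(2)[OF G nz] in \<open>auto simp: diagonal_mat_def\<close>)
  ultimately show "F = (leading n (gb_coeff X),
     Matrix.mat n n (\<lambda>(i, j). if i = j then leading_minor X (i + 1) / leading_minor X i else 0),
     leading n (gb_coeff (imat_transpose X)))" by simp
qed

text \<open>Row \<open>N\<close> is read off at order \<open>N + 1\<close>, where the minor of that
  order enters only the free last pivot; orders up to \<open>N\<close> therefore suffice.\<close>

lemma gauss_borel_entries:
  assumes nz: "\<And>m. m \<in> {1..N} \<Longrightarrow> leading_minor X m \<noteq> 0"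
  shows "gb_S X N M = gb_coeff X N M"
    and "gb_H X N = leading_minor X (N + 1) / leading_minor X N"
    and "gb_St X N M = gb_coeff (imat_transpose X) N M"
proof -
  \<comment> \<open>Order zero is the empty determinant, which is one.\<close>
  have nz': "leading_minor X m \<noteq> 0" if "m < N + 1" for m
    using that nz[of m] by (cases "m = 0") auto
  have eq: "gb_factors (N + 1) X =
    (leading (N + 1) (gb_coeff X),
     Matrix.mat (N + 1) (N + 1)
       (\<lambda>(i, j). if i = j then leading_minor X (i + 1) / leading_minor X i else 0),
     leading (N + 1) (gb_coeff (imat_transpose X)))"
    by (rule gb_factors_eq[OF nz'])
  show "gb_S X N M = gb_coeff X N M"
    unfolding gb_S_def eq by (simp add: gb_coeff_def)
  show "gb_H X N = leading_minor X (N + 1) / leading_minor X N"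
    unfolding gb_H_def eq by simp
  show "gb_St X N M = gb_coeff (imat_transpose X) N M"
    unfolding gb_St_def eq by (simp add: gb_coeff_def)
qed

section \<open>Continuity of the Gauss-Borel objects\<close>

lemma tendsto_det:
  fixes F :: "'a \<Rightarrow> real mat"
  assumes F: "\<And>t. F t \<in> carrier_mat n n" and A: "A \<in> carrier_mat n n"
    and lim: "\<And>i j. i < n \<Longrightarrow> j < n \<Longrightarrow> ((\<lambda>t. F t $$ (i, j)) \<longlongrightarrow> A $$ (i, j)) G"
  shows "((\<lambda>t. Determinant.det (F t)) \<longlongrightarrow> Determinant.det A) G"
  unfolding det_def'[OF F] det_def'[OF A]
  by (intro tendsto_sum tendsto_mult tendsto_const tendsto_prod lim)
    (auto simp: permutes_in_image)

lemma tendsto_cofactor_leading: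
  assumes "\<And>i j. i < n \<Longrightarrow> j < n \<Longrightarrow> ((\<lambda>t. F t i j) \<longlongrightarrow> X i j) G" "k < n" "l < n"
  shows "((\<lambda>t. cofactor (leading n (F t)) k l) \<longlongrightarrow> cofactor (leading n X) k l) G"
  unfolding cofactor_def
  by (intro tendsto_mult tendsto_const tendsto_det[where n = "n - 1"] mat_delete_carrier)
    (use assms in \<open>auto simp: mat_delete_def\<close>)

lemma tendsto_leading_minor:
  assumes "\<And>i j. i < n \<Longrightarrow> j < n \<Longrightarrow> ((\<lambda>t. F t i j) \<longlongrightarrow> X i j) G"
  shows "((\<lambda>t. leading_minor (F t) n) \<longlongrightarrow> leading_minor X n) G"
  unfolding leading_minor_def by (rule tendsto_det[where n = n]) (use assms in auto)

lemma eventually_leading_minor_nonzero: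
  assumes "\<And>i j. ((\<lambda>t. F t i j) \<longlongrightarrow> X i j) G" and "leading_minor X n \<noteq> 0"
  shows "\<forall>\<^sub>F t in G. leading_minor (F t) n \<noteq> 0"
  by (rule tendsto_imp_eventually_ne[OF tendsto_leading_minor assms(2)]) (use assms(1) in auto)

lemma eventually_leading_minors_nonzero:
  assumes "\<And>i j. ((\<lambda>t. F t i j) \<longlongrightarrow> X i j) G" and "\<And>n. n \<in> {1..N} \<Longrightarrow> leading_minor X n \<noteq> 0"
  shows "\<forall>\<^sub>F t in G. \<forall>n\<in>{1..N}. leading_minor (F t) n \<noteq> 0"
  using assms by (auto intro!: eventually_ball_finite eventually_leading_minor_nonzero)

lemma tendsto_gb_coeff:
  assumes lim: "\<And>i j. ((\<lambda>t. F t i j) \<longlongrightarrow> X i j) G" and nz: "leading_minor X N \<noteq> 0"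
  shows "((\<lambda>t. gb_coeff (F t) N M) \<longlongrightarrow> gb_coeff X N M) G"
  unfolding gb_coeff_def
  by (auto intro!: tendsto_divide tendsto_cofactor_leading tendsto_leading_minor lim nz)

lemma tendsto_imat_transpose:
  assumes "\<And>i j. ((\<lambda>t. F t i j) \<longlongrightarrow> X i j) G"
  shows "((\<lambda>t. imat_transpose (F t) i j) \<longlongrightarrow> imat_transpose X i j) G"
  using assms by (simp add: imat_transpose_def)

context
  fixes F :: "'a \<Rightarrow> imat" and X :: imat and G :: "'a filter" and N :: nat
  assumes lim: "\<And>i j. ((\<lambda>t. F t i j) \<longlongrightarrow> X i j) G"
    and nz: "\<And>n. n \<in> {1..N} \<Longrightarrow> leading_minor X n \<noteq> 0"
begin

lemma nonzero_minor: "leading_minor X N \<noteq> 0"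
  using nz[of N] by (cases N) auto

text \<open>The cofactor formula is continuous where the limiting minor is nonzero, and the same
  condition makes the formula valid for \<open>F t\<close> eventually.\<close>

lemma tendsto_gb_S: "((\<lambda>t. gb_S (F t) N M) \<longlongrightarrow> gb_S X N M) G"
proof (rule Lim_transform_eventually)
  show "((\<lambda>t. gb_coeff (F t) N M) \<longlongrightarrow> gb_S X N M) G"
    using tendsto_gb_coeff[OF lim nonzero_minor] gauss_borel_entries(1)[of N X M] nz by simp
  have "\<forall>\<^sub>F t in G. \<forall>n\<in>{1..N}. leading_minor (F t) n \<noteq> 0"
    by (rule eventually_leading_minors_nonzero[OF lim nz])
  then show "\<forall>\<^sub>F t in G. gb_coeff (F t) N M = gb_S (F t) N M"
    by eventually_elim (rule gauss_borel_entries(1)[symmetric], blast)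
qed

lemma tendsto_gb_St: "((\<lambda>t. gb_St (F t) N M) \<longlongrightarrow> gb_St X N M) G"
proof (rule Lim_transform_eventually)
  have "((\<lambda>t. gb_coeff (imat_transpose (F t)) N M) \<longlongrightarrow> gb_coeff (imat_transpose X) N M) G"
    by (rule tendsto_gb_coeff) (use nonzero_minor lim in \<open>auto intro: tendsto_imat_transpose\<close>)
  then show "((\<lambda>t. gb_coeff (imat_transpose (F t)) N M) \<longlongrightarrow> gb_St X N M) G"
    using gauss_borel_entries(3)[of N X M] nz by simp
  have "\<forall>\<^sub>F t in G. \<forall>n\<in>{1..N}. leading_minor (F t) n \<noteq> 0"
    by (rule eventually_leading_minors_nonzero[OF lim nz])
  then show "\<forall>\<^sub>F t in G. gb_coeff (imat_transpose (F t)) N M = gb_St (F t) N M"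
    by eventually_elim (rule gauss_borel_entries(3)[symmetric], blast)
qed

text \<open>The minor of order \<open>N + 1\<close> stands only in the numerator, so the limiting
  pivot may still be zero here.\<close>

lemma tendsto_gb_H: "((\<lambda>t. gb_H (F t) N) \<longlongrightarrow> gb_H X N) G"
proof (rule Lim_transform_eventually)
  have "((\<lambda>t. leading_minor (F t) (N + 1) / leading_minor (F t) N) \<longlongrightarrow>
      leading_minor X (N + 1) / leading_minor X N) G"
    by (intro tendsto_divide tendsto_leading_minor lim nonzero_minor)
  then show "((\<lambda>t. leading_minor (F t) (N + 1) / leading_minor (F t) N) \<longlongrightarrow> gb_H X N) G"
    using gauss_borel_entries(2)[of N X] nz by simp
  have "\<forall>\<^sub>F t in G. \<forall>n\<in>{1..N}. leading_minor (F t) n \<noteq> 0"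
    by (rule eventually_leading_minors_nonzero[OF lim nz])
  then show "\<forall>\<^sub>F t in G. leading_minor (F t) (N + 1) / leading_minor (F t) N = gb_H (F t) N"
    by eventually_elim (rule gauss_borel_entries(2)[symmetric], blast)
qed

end

lemma lower_inverse_gb_S:
  assumes "\<And>n. n \<in> {1..N} \<Longrightarrow> leading_minor X n \<noteq> 0"
  shows "lower_inverse (gb_S X) N M =
    (if M \<le> N then cofactor (leading (N + 1) (gb_S X)) M N else 0)"
proof -
  have "gb_S X i i = 1" if "i \<le> N" for i
  proof -
    have "leading_minor X i \<noteq> 0" using assms[of i] that by (cases i) auto
    moreover have "gb_S X i i = gb_coeff X i i"
      by (rule gauss_borel_entries) (use assms that in auto)
    ultimately show ?thesis by (simp add: gb_coeff_diag)
  qed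
  then have "unit_lower_triangular (leading (N + 1) (gb_S X))"
    by (auto simp: unit_lower_triangular_def) (simp add: gb_S_def)
  from unit_lower_triangular_inverse(1)[OF leading_carrier this] show ?thesis
    by (simp add: lower_inverse_def adj_mat_def)
qed

lemma tendsto_lower_inverse_gb_S:
  assumes lim: "\<And>i j. ((\<lambda>t. F t i j) \<longlongrightarrow> X i j) G"
    and nz: "\<And>n. n \<in> {1..N} \<Longrightarrow> leading_minor X n \<noteq> 0"
  shows "((\<lambda>t. lower_inverse (gb_S (F t)) N M) \<longlongrightarrow> lower_inverse (gb_S X) N M) G"
proof -
  have *: "((\<lambda>t. if M \<le> N then cofactor (leading (N + 1) (gb_S (F t))) M N else 0) \<longlongrightarrow>
      (if M \<le> N then cofactor (leading (N + 1) (gb_S X)) M N else 0)) G"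
    using nz by (auto intro!: tendsto_cofactor_leading tendsto_gb_S lim)
  have "\<forall>\<^sub>F t in G. \<forall>n\<in>{1..N}. leading_minor (F t) n \<noteq> 0"
    by (rule eventually_leading_minors_nonzero[OF lim nz])
  then have "\<forall>\<^sub>F t in G. (if M \<le> N then cofactor (leading (N + 1) (gb_S (F t))) M N else 0) =
      lower_inverse (gb_S (F t)) N M"
    by eventually_elim (rule lower_inverse_gb_S[symmetric], blast)
  moreover have "lower_inverse (gb_S X) N M =
      (if M \<le> N then cofactor (leading (N + 1) (gb_S X)) M N else 0)"
    by (rule lower_inverse_gb_S) (rule nz)
  ultimately show ?thesis using Lim_transform_eventually[OF *] by presburger
qed

section \<open>Products with shifts and the Christoffel chains\<close>

lemma imat_mult_eq_sum:
  assumes "finite A" "\<And>k. k \<notin> A \<Longrightarrow> X N k * Y k M = 0"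
  shows "(X \<odot> Y) N M = (\<Sum>k\<in>A. X N k * Y k M)"
  unfolding imat_mult_def by (rule Sum_any.expand_superset) (use assms in auto)

lemma shift_pow_apply: "shift_pow k N M = (if M = N + k then 1 else 0)"
proof (induction k arbitrary: N)
  case (Suc k)
  have "shift_pow (Suc k) N M = (\<Sum>l\<in>{N + 1}. shift N l * shift_pow k l M)"
    unfolding shift_pow.simps by (rule imat_mult_eq_sum) (auto simp: shift_def)
  then show ?case using Suc by (simp add: shift_def)
qed auto

lemma shift_eq_shift_pow: "shift = shift_pow 1"
  by (simp add: fun_eq_iff shift_pow_apply del: shift_pow.simps) (simp add: shift_def)

lemma imat_mult_shift_pow: "(X \<odot> shift_pow k) N M = (if k \<le> M then X N (M - k) else 0)"
  by (subst imat_mult_eq_sum[where A = "{M - k}"]) (auto simp: shift_pow_apply)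

lemma row_chain_apply: "row_chain k X N M = X (N + k) M"
  unfolding row_chain_def
  by (subst imat_mult_eq_sum[where A = "{N + k}"]) (auto simp: shift_pow_apply)

lemma column_chain_apply: "column_chain k X N M = X N (M + k)"
  unfolding column_chain_def
  by (subst imat_mult_eq_sum[where A = "{M + k}"]) (auto simp: shift_pow_apply imat_transpose_def)

lemma row_chain_0 [simp]: "row_chain 0 X = X"
  by (simp add: fun_eq_iff row_chain_apply)

lemma column_chain_0 [simp]: "column_chain 0 X = X"
  by (simp add: fun_eq_iff column_chain_apply)

text \<open>Row \<open>N\<close> of the shifted left factor is supported in the columns
  \<open>q\<close> to \<open>N + q\<close>. The sum is therefore finite, and the rows of
  \<open>Y\<close> up to \<open>N + q\<close> account for the orders of the minors that are
  used.\<close>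

lemma gb_S_shift_mult_eq_sum:
  "(gb_S X \<odot> shift_pow q \<odot> Y) N M =
    (\<Sum>k\<le>N + q. (if q \<le> k then gb_S X N (k - q) else 0) * Y k M)"
  by (subst imat_mult_eq_sum[where A = "{..N + q}"])
    (auto simp: imat_mult_shift_pow gb_S_def)

lemma tendsto_gb_S_shift_lower_inverse:
  assumes lim: "\<And>i j. ((\<lambda>t. F t i j) \<longlongrightarrow> X i j) G" "\<And>i j. ((\<lambda>t. E t i j) \<longlongrightarrow> Y i j) G"
    and nz: "\<And>n. n \<in> {1..N} \<Longrightarrow> leading_minor X n \<noteq> 0"
      "\<And>n. n \<in> {1..N + q} \<Longrightarrow> leading_minor Y n \<noteq> 0"
  shows "((\<lambda>t. (gb_S (F t) \<odot> shift_pow q \<odot> lower_inverse (gb_S (E t))) N M) \<longlongrightarrow>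
    (gb_S X \<odot> shift_pow q \<odot> lower_inverse (gb_S Y)) N M) G"
  unfolding gb_S_shift_mult_eq_sum
  using nz by (auto intro!: tendsto_sum tendsto_mult tendsto_gb_S tendsto_lower_inverse_gb_S lim)

lemma tendsto_gb_S_lower_inverse:
  assumes lim: "\<And>i j. ((\<lambda>t. F t i j) \<longlongrightarrow> X i j) G" "\<And>i j. ((\<lambda>t. E t i j) \<longlongrightarrow> Y i j) G"
    and nz: "\<And>n. n \<in> {1..N} \<Longrightarrow> leading_minor X n \<noteq> 0"
      "\<And>n. n \<in> {1..N} \<Longrightarrow> leading_minor Y n \<noteq> 0"
  shows "((\<lambda>t. (gb_S (F t) \<odot> lower_inverse (gb_S (E t))) N M) \<longlongrightarrow>
    (gb_S X \<odot> lower_inverse (gb_S Y)) N M) G"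
proof -
  have eq: "(gb_S Z \<odot> W) N M = (\<Sum>k\<le>N. gb_S Z N k * W k M)" for Z W
    by (rule imat_mult_eq_sum) (auto simp: gb_S_def)
  show ?thesis unfolding eq
    using nz by (auto intro!: tendsto_sum tendsto_mult tendsto_gb_S tendsto_lower_inverse_gb_S lim)
qed

text \<open>Purely algebraic transfer for any family of matrices that converges entrywise; nothing
  about weights enters.\<close>

lemma gauss_borel_objects_converge:
  assumes lim: "\<And>i j. ((\<lambda>t. F t i j) \<longlongrightarrow> X i j) G" and q: "q \<ge> 1"
    and nz: "used_minors_nonzero p q K X"
  shows "\<forall>\<^sub>F t in G. used_minors_nonzero p q K (F t)"
    and "N \<le> K \<Longrightarrow> ((\<lambda>t. A_coeff (F t) N M) \<longlongrightarrow> A_coeff X N M) G"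
    and "N \<le> K \<Longrightarrow> ((\<lambda>t. B_coeff (F t) N M) \<longlongrightarrow> B_coeff X N M) G"
    and "N \<le> K \<Longrightarrow> ((\<lambda>t. recurrence_matrix q (F t) N M) \<longlongrightarrow> recurrence_matrix q X N M) G"
    and "N \<le> K \<Longrightarrow> k \<in> {1..p} \<Longrightarrow> ((\<lambda>t. lower_factor (F t) k N M) \<longlongrightarrow> lower_factor X k N M) G"
    and "N \<le> K \<Longrightarrow> k \<in> {1..q} \<Longrightarrow> ((\<lambda>t. upper_factor (F t) k N M) \<longlongrightarrow> upper_factor X k N M) G"
proof -
  have nz0: "leading_minor X n \<noteq> 0" if "n \<in> {1..K + q}" for n
    using nz that by (auto simp: used_minors_nonzero_def)
  \<comment> \<open>Index \<open>0\<close> of either chain is \<open>X\<close> itself; its minors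
    are available up to \<open>K + q\<close>, which covers \<open>K + 1\<close> because
    \<open>q \<ge> 1\<close>.\<close>
  have nzr: "leading_minor (row_chain k X) n \<noteq> 0" if "k \<le> q" "n \<in> {1..K + 1}" for k n
    using nz that nz0 q by (cases "k = 0") (auto simp: used_minors_nonzero_def)
  have nzc: "leading_minor (column_chain k X) n \<noteq> 0"
    if "k \<le> p" "n \<in> {1..if k < p then K + 1 else K}" for k n
  proof (cases "k = 0")
    case True then show ?thesis using that nz0 q by (auto split: if_splits)
  next
    case False
    then have "k \<in> {1..p}" using that by auto
    then show ?thesis using nz that unfolding used_minors_nonzero_def by blast
  qed
  have limr: "((\<lambda>t. row_chain k (F t) i j) \<longlongrightarrow> row_chain k X i j) G" for k i j
    using lim by (simp add: row_chain_apply)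
  have limc: "((\<lambda>t. column_chain k (F t) i j) \<longlongrightarrow> column_chain k X i j) G" for k i j
    using lim by (simp add: column_chain_apply)
  show "\<forall>\<^sub>F t in G. used_minors_nonzero p q K (F t)"
    unfolding used_minors_nonzero_def
    using nz0 nzr nzc
    by (auto intro!: eventually_conj eventually_ball_finite eventually_leading_minor_nonzero lim
        limr limc)
  assume N: "N \<le> K"
  show "((\<lambda>t. A_coeff (F t) N M) \<longlongrightarrow> A_coeff X N M) G"
  proof -
    \<comment> \<open>\<open>A_coeff\<close> divides by the pivot, so the minor of order
      \<open>N + 1 \<le> K + q\<close> has to be nonzero as well.\<close>
    have "leading_minor X N \<noteq> 0" using nz0[of N] N by (cases N) auto
    moreover have "leading_minor X (N + 1) \<noteq> 0" using nz0[of "N + 1"] N q by auto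
    moreover have "gb_H X N = leading_minor X (N + 1) / leading_minor X N"
      by (rule gauss_borel_entries) (use nz0 N in auto)
    ultimately have "gb_H X N \<noteq> 0" by simp
    then show ?thesis
      unfolding A_coeff_def using nz0 N
      by (intro tendsto_mult tendsto_inverse tendsto_gb_H tendsto_gb_St lim) auto
  qed
  show "((\<lambda>t. B_coeff (F t) N M) \<longlongrightarrow> B_coeff X N M) G"
    unfolding B_coeff_def using nz0 N by (intro tendsto_gb_S lim) auto
  show "((\<lambda>t. recurrence_matrix q (F t) N M) \<longlongrightarrow> recurrence_matrix q X N M) G"
    unfolding recurrence_matrix_def using nz0 N by (intro tendsto_gb_S_shift_lower_inverse lim) auto
  show "((\<lambda>t. lower_factor (F t) k N M) \<longlongrightarrow> lower_factor X k N M) G" if k: "k \<in> {1..p}"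
    unfolding lower_factor_def
  \<comment> \<open>Without a shift, both factors are used only up to row \<open>N \<le> K\<close>;
    this fits the case \<open>k = p\<close>, where orders stop at \<open>K\<close>.\<close>
  proof (rule tendsto_gb_S_lower_inverse[OF limc limc])
    show "leading_minor (column_chain (k - 1) X) n \<noteq> 0" if "n \<in> {1..N}" for n
      by (rule nzc) (use that k N in auto)
    show "leading_minor (column_chain k X) n \<noteq> 0" if "n \<in> {1..N}" for n
      by (rule nzc) (use that k N in auto)
  qed
  show "((\<lambda>t. upper_factor (F t) k N M) \<longlongrightarrow> upper_factor X k N M) G" if k: "k \<in> {1..q}"
    unfolding upper_factor_def shift_eq_shift_pow
    by (rule tendsto_gb_S_shift_lower_inverse[OF limr limr]) (use k N nzr in auto)
qed

section \<open>Power moments of Mellin convolutions\<close>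

text \<open>Integrability and value are kept together because Fubini and linearity need both at
  every stage. The exponent is real on account of the column parameters, and the indicator discards
  values off the half-line.\<close>

definition has_moment :: "(real \<Rightarrow> real) \<Rightarrow> real \<Rightarrow> real \<Rightarrow> bool" where
  "has_moment f m v \<longleftrightarrow>
     has_bochner_integral lborel (\<lambda>x. indicator {0<..} x * (x powr m * f x)) v"

lemma has_moment_cong:
  assumes "\<And>x. x > 0 \<Longrightarrow> f x = g x"
  shows "has_moment f m v \<longleftrightarrow> has_moment g m v"
  unfolding has_moment_def
  by (rule has_bochner_integral_cong) (auto simp: indicator_def assms)

lemma has_moment_cmult: "has_moment f m v \<Longrightarrow> has_moment (\<lambda>x. c * f x) m (c * v)"
  using has_bochner_integral_mult_right[of c lborel "\<lambda>x. indicator {0<..} x * (x powr m * f x)" v]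
  by (simp add: has_moment_def mult.left_commute)

lemma has_moment_sum:
  assumes "\<And>i. i \<in> I \<Longrightarrow> has_moment (f i) m (v i)"
  shows "has_moment (\<lambda>x. \<Sum>i\<in>I. f i x) m (\<Sum>i\<in>I. v i)"
  using has_bochner_integral_sum[of I lborel "\<lambda>i x. indicator {0<..} x * (x powr m * f i x)" v] assms
  by (simp add: has_moment_def sum_distrib_left)

lemma has_moment_scale:
  assumes f: "has_moment f m v" and c: "c > 0"
  shows "has_moment (\<lambda>x. f (x / c)) m (c powr (m + 1) * v)"
  unfolding has_moment_def
proof (rule lborel_has_bochner_integral_real_affine_iff[where c = c and t = 0, THEN iffD2])
  have "has_bochner_integral lborel (\<lambda>x. c powr m * (indicator {0<..} x * (x powr m * f x))) (c powr m * v)"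
    using f by (intro has_bochner_integral_mult_right) (auto simp: has_moment_def)
  also have "(\<lambda>x. c powr m * (indicator {0<..} x * (x powr m * f x))) =
      (\<lambda>x. indicator {0<..} (0 + c * x) * ((0 + c * x) powr m * f ((0 + c * x) / c)))"
    using c by (auto simp: fun_eq_iff indicator_def powr_mult zero_less_mult_iff)
  also have "c powr m * v = (c powr (m + 1) * v) /\<^sub>R \<bar>c\<bar>"
    using c by (simp add: powr_add field_simps)
  finally show "has_bochner_integral lborel
      (\<lambda>x. indicator {0<..} (0 + c * x) * ((0 + c * x) powr m * f ((0 + c * x) / c)))
      ((c powr (m + 1) * v) /\<^sub>R \<bar>c\<bar>)" .
qed (use c in auto)

lemma borel_measurable_mellin_conv [measurable]:
  assumes [measurable]: "f \<in> borel_measurable borel" "g \<in> borel_measurable borel"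
  shows "mellin_conv f g \<in> borel_measurable borel"
proof -
  have "(\<lambda>x. mellin_conv f g x) \<in> borel_measurable lborel"
    unfolding mellin_conv_def set_lebesgue_integral_def by measurable
  then show ?thesis by simp
qed

text \<open>For fixed \<open>u\<close> the substitution \<open>x = u y\<close> turns the inner
  integral into \<open>u powr (m + 1) * w\<close>; the factor \<open>1 / u\<close> then leaves
  exactly the moment integrand of \<open>f\<close>.\<close>

lemma has_moment_mellin_conv:
  assumes [measurable]: "f \<in> borel_measurable borel" "g \<in> borel_measurable borel"
    and f: "has_moment f m v" and g: "has_moment g m w"
  shows "has_moment (mellin_conv f g) m (v * w)"
proof -
  define P where "P f g u x =
    indicator {0<..} x * (x powr m * (indicator {0<..} u * (f u * g (x / u) / u)))"
    for f g :: "real \<Rightarrow> real" and u x :: real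
  \<comment> \<open>Stated for arbitrary weights because it serves twice: with absolute values for
    joint integrability, and with the weights themselves for the evaluation.\<close>
  have inner: "has_bochner_integral lborel (P f g u) (indicator {0<..} u * (u powr m * f u) * w)"
    if g: "has_moment g m w" for f g u w
  proof (cases "u > 0")
    case True
    have "has_moment (\<lambda>x. f u / u * g (x / u)) m (f u / u * (u powr (m + 1) * w))"
      by (intro has_moment_cmult has_moment_scale g True)
    then show ?thesis using True
      by (simp add: has_moment_def P_def[abs_def] powr_add ac_simps)
  next
    case False then show ?thesis by (simp add: P_def[abs_def] has_bochner_integral_zero)
  qed
  define W where "W = (\<integral>x. \<bar>indicator {0<..} x * (x powr m * g x)\<bar> \<partial>lborel)"
  have g': "has_moment (\<lambda>x. \<bar>g x\<bar>) m W"
    using g integrable_abs[of lborel "\<lambda>x. indicator {0<..} x * (x powr m * g x)"]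
    by (auto simp: has_moment_def has_bochner_integral_iff W_def abs_mult)
  have absP: "norm (P f g u x) = P (\<lambda>x. \<bar>f x\<bar>) (\<lambda>x. \<bar>g x\<bar>) u x" for u x
    by (auto simp: P_def abs_mult indicator_def)
  have fint: "integrable lborel (\<lambda>u. indicator {0<..} u * (u powr m * f u))"
    using f by (auto simp: has_moment_def has_bochner_integral_iff)
  have int: "integrable (lborel \<Otimes>\<^sub>M lborel) (case_prod (P f g))"
  proof (rule lborel_pair.Fubini_integrable)
    show "case_prod (P f g) \<in> borel_measurable (lborel \<Otimes>\<^sub>M lborel)"
      unfolding P_def by measurable
    have "(\<lambda>u. \<integral>x. norm (P f g u x) \<partial>lborel) =
        (\<lambda>u. indicator {0<..} u * (u powr m * \<bar>f u\<bar>) * W)"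
      using inner[OF g', of "\<lambda>x. \<bar>f x\<bar>"] unfolding absP
      by (auto simp: has_bochner_integral_iff)
    moreover have "integrable lborel (\<lambda>u. indicator {0<..} u * (u powr m * \<bar>f u\<bar>) * W)"
      using integrable_abs[OF fint] by (auto simp: abs_mult)
    ultimately show "integrable lborel (\<lambda>u. \<integral>x. norm (case_prod (P f g) (u, x)) \<partial>lborel)"
      by simp
    show "AE u in lborel. integrable lborel (\<lambda>x. case_prod (P f g) (u, x))"
      using inner[OF g, of f] by (auto simp: has_bochner_integral_iff)
  qed
  have eq: "(\<integral>u. P f g u x \<partial>lborel) = indicator {0<..} x * (x powr m * mellin_conv f g x)" for x
  proof -
    have "P f g u x = indicator {0<..} x * x powr m * (indicator {0<..} u *\<^sub>R (f u * g (x / u) / u))" for u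
      by (simp add: P_def)
    then show ?thesis
      by (simp only: mellin_conv_def set_lebesgue_integral_def integral_mult_right_zero mult.assoc)
  qed
  have "(\<integral>x. (\<integral>u. P f g u x \<partial>lborel) \<partial>lborel) = (\<integral>u. (\<integral>x. P f g u x \<partial>lborel) \<partial>lborel)"
    by (rule lborel_pair.Fubini_integral[OF int])
  also have "\<dots> = (\<integral>u. indicator {0<..} u * (u powr m * f u) * w \<partial>lborel)"
    using inner[OF g, of f] by (auto simp: has_bochner_integral_iff)
  also have "\<dots> = v * w" using f by (auto simp: has_moment_def has_bochner_integral_iff)
  finally show ?thesis
    using lborel_pair.integrable_snd[OF int] unfolding has_moment_def has_bochner_integral_iff eq by simp
qed

section \<open>Iterated convolutions: moments and support\<close>

lemma mellin_convs_single [simp]: "mellin_convs [f] = f"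
  by (simp add: mellin_convs_def)

lemma mellin_convs_snoc: "fs \<noteq> [] \<Longrightarrow> mellin_convs (fs @ [g]) = mellin_conv (mellin_convs fs) g"
  by (simp add: mellin_convs_def)

lemma borel_measurable_mellin_convs:
  assumes "fs \<noteq> []" "\<And>f. f \<in> set fs \<Longrightarrow> f \<in> borel_measurable borel"
  shows "mellin_convs fs \<in> borel_measurable borel"
  using assms
proof (induction fs rule: rev_nonempty_induct)
  case (snoc g fs)
  then show ?case by (auto simp: mellin_convs_snoc intro!: borel_measurable_mellin_conv)
qed simp

lemma has_moment_mellin_convs:
  assumes "xs \<noteq> []" "\<And>x. x \<in> set xs \<Longrightarrow> f x \<in> borel_measurable borel"
    and "\<And>x. x \<in> set xs \<Longrightarrow> has_moment (f x) m (v x)"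
  shows "has_moment (mellin_convs (map f xs)) m (prod_list (map v xs))"
  using assms
proof (induction xs rule: rev_nonempty_induct)
  case (snoc x xs)
  then show ?case
    by (auto simp: mellin_convs_snoc intro!: has_moment_mellin_conv borel_measurable_mellin_convs)
qed simp

text \<open>For \<open>x \<ge> 1\<close> and \<open>u > 0\<close>, either \<open>u \<ge> 1\<close>
  or \<open>x / u \<ge> 1\<close>, so one factor of the integrand vanishes.\<close>

lemma mellin_convs_eq_0:
  assumes "fs \<noteq> []" "\<And>f x. f \<in> set fs \<Longrightarrow> x \<ge> 1 \<Longrightarrow> f x = 0" and "x \<ge> 1"
  shows "mellin_convs fs x = 0"
  using assms
proof (induction fs arbitrary: x rule: rev_nonempty_induct)
  case (snoc g fs)
  have "mellin_convs fs u * g (x / u) / u = 0" if "u > 0" for u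
  proof (cases "u \<ge> 1")
    case True then show ?thesis using snoc by simp
  next
    case False
    then have "x / u \<ge> 1" using that snoc.prems by (simp add: field_simps)
    then show ?thesis using snoc.prems by simp
  qed
  then have "(\<lambda>u. indicator {0<..} u *\<^sub>R (mellin_convs fs u * g (x / u) / u)) = (\<lambda>u. 0)"
    by (auto simp: indicator_def fun_eq_iff)
  then show ?case using snoc
    by (simp add: mellin_convs_snoc mellin_conv_def set_lebesgue_integral_def)
qed simp

section \<open>Moments of the Beta and Gamma weights\<close>

lemma has_integral_imp_has_bochner_integral:
  fixes f :: "real \<Rightarrow> real"
  assumes nn: "\<And>x. x \<in> S \<Longrightarrow> 0 \<le> f x" and I: "(f has_integral I) S"
    and [measurable]: "f \<in> borel_measurable borel" "S \<in> sets borel"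
  shows "has_bochner_integral lborel (\<lambda>x. indicator S x * f x) I"
proof (rule has_bochner_integral_nn_integral)
  show "0 \<le> I" using has_integral_nonneg[OF I] nn by auto
  show "(\<integral>\<^sup>+ x. ennreal (indicator S x * f x) \<partial>lborel) = ennreal I"
    by (rule nn_integral_has_integral_lebesgue[OF nn I])
qed (auto simp: indicator_def nn)

lemma borel_measurable_gamma_weight [measurable]: "gamma_weight a \<in> borel_measurable borel"
  unfolding gamma_weight_def[abs_def] by measurable

lemma borel_measurable_beta_weight [measurable]: "beta_weight a b \<in> borel_measurable borel"
  unfolding beta_weight_def[abs_def] by measurable

lemma has_moment_gamma_weight:
  assumes "m + a > - 1"
  shows "has_moment (gamma_weight a) m (Gamma (m + a + 1))"
proof -
  have "has_bochner_integral lborel (\<lambda>t. indicator {0..} t * (t powr (m + a + 1 - 1) / exp t))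
      (Gamma (m + a + 1))"
    by (rule has_integral_imp_has_bochner_integral[OF _ Gamma_integral_real]) (use assms in auto)
  moreover have "(\<lambda>t. indicator {0..} t * (t powr (m + a + 1 - 1) / exp t)) =
      (\<lambda>x. indicator {0<..} x * (x powr m * gamma_weight a x))"
    by (auto simp: fun_eq_iff indicator_def gamma_weight_def powr_add exp_minus field_simps)
  ultimately show ?thesis by (simp add: has_moment_def)
qed

lemma has_moment_beta_weight:
  assumes "m + a > - 1" "a < b"
  shows "has_moment (beta_weight a b) m (Gamma (m + a + 1) / Gamma (m + b + 1))"
proof -
  have "has_bochner_integral lborel
      (\<lambda>t. indicator {0..1} t * (t powr (m + a + 1 - 1) * (1 - t) powr (b - a - 1)))
      (Beta (m + a + 1) (b - a))"
    by (rule has_integral_imp_has_bochner_integral[OF _ has_integral_Beta_real]) (use assms in auto)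
  from has_bochner_integral_mult_right[OF this, of "1 / Gamma (b - a)"]
  have "has_bochner_integral lborel
      (\<lambda>t. 1 / Gamma (b - a) * (indicator {0..1} t * (t powr (m + a + 1 - 1) * (1 - t) powr (b - a - 1))))
      (1 / Gamma (b - a) * Beta (m + a + 1) (b - a))" by simp
  moreover have "(\<lambda>t. 1 / Gamma (b - a) * (indicator {0..1} t * (t powr (m + a + 1 - 1) * (1 - t) powr (b - a - 1)))) =
      (\<lambda>x. indicator {0<..} x * (x powr m * beta_weight a b x))"
    by (auto simp: fun_eq_iff indicator_def beta_weight_def powr_add)
  moreover have "1 / Gamma (b - a) * Beta (m + a + 1) (b - a) = Gamma (m + a + 1) / Gamma (m + b + 1)"
  proof -
    have "Gamma (b - a) > 0" using assms by (intro Gamma_real_pos) simp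
    then show ?thesis by (simp add: Beta_def algebra_simps)
  qed
  ultimately show ?thesis by (simp add: has_moment_def)
qed

section \<open>A ratio of Gamma functions\<close>

text \<open>\<open>x + s\<close> is a convex combination of \<open>x\<close> and
  \<open>x + 1\<close>, and Gamma is logarithmically convex.\<close>

lemma Gamma_add_le:
  fixes x s :: real
  assumes "x > 0" "0 \<le> s" "s \<le> 1"
  shows "Gamma (x + s) \<le> x powr s * Gamma x"
proof -
  have pos: "Gamma x > 0" "Gamma (x + s) > 0" using assms by (auto intro!: Gamma_real_pos)
  have "ln (Gamma ((1 - s) *\<^sub>R x + s *\<^sub>R (x + 1))) \<le> (1 - s) * ln (Gamma x) + s * ln (Gamma (x + 1))"
    using convex_onD[OF log_convex_Gamma_real, of s x "x + 1"] assms by (simp add: o_def)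
  also have "(1 - s) *\<^sub>R x + s *\<^sub>R (x + 1) = x + s" by (simp add: algebra_simps)
  also have "Gamma (x + 1) = x * Gamma x" by (rule Gamma_plus1) (use assms in auto)
  finally have "ln (Gamma (x + s)) \<le> (1 - s) * ln (Gamma x) + s * ln (x * Gamma x)" by simp
  also have "\<dots> = ln (x powr s * Gamma x)"
    using assms pos by (simp add: ln_mult ln_powr algebra_simps)
  finally show ?thesis using assms pos by simp
qed

text \<open>Log-convexity is used on both sides: from \<open>k + 1\<close> up to
  \<open>k + 1 + y\<close> for the lower bound, and from \<open>k + 1 + y\<close> up to
  \<open>k + 2\<close> for the upper one.\<close>

lemma Gamma_ratio_tendsto_1_aux:
  fixes y :: real
  assumes "0 \<le> y" "y \<le> 1"
  shows "((\<lambda>k. k powr y * Gamma (k + 1) / Gamma (k + 1 + y)) \<longlongrightarrow> 1) at_top"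
proof (rule tendsto_sandwich)
  show "((\<lambda>k::real. (k / (k + 1)) powr y) \<longlongrightarrow> 1) at_top" by real_asymp
  show "((\<lambda>k::real. (k / (k + 1 + y)) powr y * ((k + 1 + y) / (k + 1))) \<longlongrightarrow> 1) at_top" by real_asymp
  show "\<forall>\<^sub>F k in at_top. (k / (k + 1)) powr y \<le> k powr y * Gamma (k + 1) / Gamma (k + 1 + y)"
    using eventually_gt_at_top[of 0]
  proof eventually_elim
    case (elim k)
    have "Gamma (k + 1) > 0" "Gamma (k + 1 + y) > 0"
      using elim assms by (auto intro!: Gamma_real_pos)
    moreover have "Gamma (k + 1 + y) \<le> (k + 1) powr y * Gamma (k + 1)"
      by (rule Gamma_add_le) (use elim assms in auto)
    ultimately show ?case using elim by (simp add: powr_divide field_simps)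
  qed
  show "\<forall>\<^sub>F k in at_top. k powr y * Gamma (k + 1) / Gamma (k + 1 + y)
      \<le> (k / (k + 1 + y)) powr y * ((k + 1 + y) / (k + 1))"
    using eventually_gt_at_top[of 0]
  proof eventually_elim
    case (elim k)
    have pos: "Gamma (k + 1) > 0" "Gamma (k + 1 + y) > 0" "k + 1 > 0" "(k + 1 + y) powr y > 0"
      using elim assms by (auto intro!: Gamma_real_pos)
    have "Gamma (k + 1 + y + (1 - y)) \<le> (k + 1 + y) powr (1 - y) * Gamma (k + 1 + y)"
      by (rule Gamma_add_le) (use elim assms in auto)
    moreover have "Gamma (k + 1 + 1) = (k + 1) * Gamma (k + 1)"
      by (rule Gamma_plus1) (use elim in auto)
    ultimately have le: "(k + 1) * Gamma (k + 1) \<le> (k + 1 + y) powr (1 - y) * Gamma (k + 1 + y)"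
      by (simp add: add_ac)
    have "k powr y * Gamma (k + 1) / Gamma (k + 1 + y) =
        k powr y / (k + 1) * (((k + 1) * Gamma (k + 1)) / Gamma (k + 1 + y))"
      using pos(3) by (metis (no_types, opaque_lifting) less_numeral_extra(3) mult.commute
          nonzero_mult_div_cancel_left times_divide_times_eq times_divide_eq_right)
    also have "\<dots> \<le> k powr y / (k + 1) * (((k + 1 + y) powr (1 - y) * Gamma (k + 1 + y)) / Gamma (k + 1 + y))"
      using pos elim by (intro mult_left_mono divide_right_mono le) auto
    also have "\<dots> = k powr y / (k + 1) * ((k + 1 + y) / (k + 1 + y) powr y)"
      using pos(2) elim assms by (simp add: powr_diff less_imp_neq[symmetric])
    also have "\<dots> = (k / (k + 1 + y)) powr y * ((k + 1 + y) / (k + 1))"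
      using elim assms by (simp add: powr_divide)
    finally show ?case .
  qed
qed

text \<open>Raising \<open>y\<close> by one multiplies the ratio by \<open>k / (k + 1 + y)\<close>,
  which tends to one; this reduces every \<open>y\<close> to its fractional part.\<close>

lemma Gamma_ratio_tendsto_1:
  fixes y :: real
  assumes "0 \<le> y"
  shows "((\<lambda>k. k powr y * Gamma (k + 1) / Gamma (k + 1 + y)) \<longlongrightarrow> 1) at_top"
proof -
  have "((\<lambda>k. k powr (s + real n) * Gamma (k + 1) / Gamma (k + 1 + (s + real n))) \<longlongrightarrow> 1) at_top"
    if "0 \<le> s" "s \<le> 1" for s :: real and n
  proof (induction n)
    case 0 then show ?case using Gamma_ratio_tendsto_1_aux[OF that] by simp
  next
    case (Suc n)
    let ?y = "s + real n"
    have "((\<lambda>k. k / (k + 1 + ?y)) \<longlongrightarrow> 1) at_top" by real_asymp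
    from tendsto_mult[OF Suc this]
    have "((\<lambda>k. k powr ?y * Gamma (k + 1) / Gamma (k + 1 + ?y) * (k / (k + 1 + ?y))) \<longlongrightarrow> 1) at_top"
      by simp
    moreover have "\<forall>\<^sub>F k in at_top. k powr ?y * Gamma (k + 1) / Gamma (k + 1 + ?y) * (k / (k + 1 + ?y)) =
        k powr (s + real (Suc n)) * Gamma (k + 1) / Gamma (k + 1 + (s + real (Suc n)))"
      using eventually_gt_at_top[of 0]
    proof eventually_elim
      case (elim k)
      have "Gamma (k + 1 + ?y + 1) = (k + 1 + ?y) * Gamma (k + 1 + ?y)"
        by (rule Gamma_plus1) (use elim that in auto)
      moreover have "k + 1 + ?y + 1 = k + 1 + (s + real (Suc n))" by simp
      moreover have "k powr (s + real (Suc n)) = k powr ?y * k" 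
        using elim by (simp add: powr_add[symmetric] powr_mult_base add_ac mult.commute)
      ultimately show ?case by (simp only: times_divide_times_eq mult_ac)
    qed
    ultimately show ?case by (rule Lim_transform_eventually)
  qed
  from this[of "frac y" "nat \<lfloor>y\<rfloor>"] assms frac_lt_1[of y] show ?thesis
    by (simp add: frac_def)
qed

section \<open>Derivatives of a convolution with a Gamma weight\<close>

text \<open>Turns differentiation under the integral sign into the integration of one pointwise
  inequality.\<close>

lemma DERIV_quadratic_remainder:
  fixes f :: "real \<Rightarrow> real"
  assumes d: "d > 0" and bound: "\<And>h. \<bar>h\<bar> < d \<Longrightarrow> \<bar>f (x + h) - f x - h * D\<bar> \<le> B * h\<^sup>2"
  shows "(f has_real_derivative D) (at x)"
  unfolding DERIV_def
proof (rule Lim_null[THEN iffD2], rule Lim_null_comparison[where g = "\<lambda>h. B * \<bar>h\<bar>"])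
  show "\<forall>\<^sub>F h in at 0. norm ((f (x + h) - f x) / h - D) \<le> B * \<bar>h\<bar>"
    unfolding eventually_at
  proof (intro exI conjI ballI impI)
    fix h :: real assume h: "h \<noteq> 0 \<and> dist h 0 < d"
    have "(f (x + h) - f x) / h - D = (f (x + h) - f x - h * D) / h" using h by (simp add: field_simps)
    then have "norm ((f (x + h) - f x) / h - D) = \<bar>f (x + h) - f x - h * D\<bar> / \<bar>h\<bar>"
      by simp
    also have "\<dots> \<le> B * h\<^sup>2 / \<bar>h\<bar>" using bound[of h] h by (intro divide_right_mono) auto
    also have "\<dots> = B * \<bar>h\<bar>" using h by (simp add: power2_eq_square abs_if)
    finally show "norm ((f (x + h) - f x) / h - D) \<le> B * \<bar>h\<bar>" .
  qed (use d in auto)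
  show "((\<lambda>h::real. B * \<bar>h\<bar>) \<longlongrightarrow> 0) (at 0)" by (rule tendsto_eq_intros | simp)+
qed

text \<open>The bound is the maximum over \<open>v\<close>, attained at \<open>v = p / x\<close>; it
  comes from \<open>ln y \<le> y - 1\<close> at \<open>y = v * x / p\<close>.\<close>

lemma powr_times_exp_le:
  fixes p v x :: real
  assumes "p > 0" "v > 0" "x > 0"
  shows "v powr p * exp (- (x * v)) \<le> exp (p * ln (p / x) - p)"
proof -
  have "ln (v * x / p) \<le> v * x / p - 1" using assms by (intro ln_le_minus_one) auto
  then have "p * ln (v * x / p) \<le> p * (v * x / p - 1)" using assms by (intro mult_left_mono) auto
  also have "\<dots> = x * v - p" using assms by (simp add: field_simps)
  finally have "p * ln v - x * v \<le> p * ln (p / x) - p"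
    using assms by (simp add: ln_div ln_mult algebra_simps)
  then show ?thesis using assms by (simp add: powr_def exp_add[symmetric])
qed

text \<open>Second-order Taylor remainder; the crude factor \<open>exp \<bar>z\<bar>\<close> covers
  both signs and is later absorbed by exponential decay.\<close>

lemma exp_minus_remainder_le:
  fixes z :: real
  shows "\<bar>exp (- z) - 1 + z\<bar> \<le> z\<^sup>2 * exp \<bar>z\<bar>"
proof -
  obtain t where t: "\<bar>t\<bar> \<le> \<bar>- z\<bar>"
    and eq: "exp (- z) = (\<Sum>m<2. (- z) ^ m / fact m) + exp t / fact 2 * (- z) ^ 2"
    using Maclaurin_exp_le[of "- z" 2] by blast
  have e: "exp (- z) - 1 + z = exp t / 2 * z\<^sup>2" using eq by (simp add: numeral_2_eq_2)
  have "\<bar>exp (- z) - 1 + z\<bar> = exp t / 2 * z\<^sup>2" unfolding e by simp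
  also have "\<dots> \<le> exp \<bar>z\<bar> * z\<^sup>2" 
  proof (rule mult_right_mono)
    have "exp t / 2 \<le> exp t" by simp
    also have "exp t \<le> exp \<bar>z\<bar>" using t by simp
    finally show "exp t / 2 \<le> exp \<bar>z\<bar>" .
  qed simp
  finally show ?thesis by (simp add: mult.commute)
qed

text \<open>With $\theta = -x\,\mathrm d/\mathrm dx$ one has
  $\theta\mathcal G_a = \mathcal G_{a+1} - a\,\mathcal G_a$, hence
  $\theta^n\mathcal G_a = \sum_{k \le n} c_{n,k}\,\mathcal G_{a+k}$ with \<open>c = theta_coeff a\<close>; and $\theta$
  acts on a Mellin convolution through either factor.\<close>

primrec theta_coeff :: "real \<Rightarrow> nat \<Rightarrow> nat \<Rightarrow> real" where
  "theta_coeff a 0 k = (if k = 0 then 1 else 0)"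
| "theta_coeff a (Suc n) k =
     (if k = 0 then 0 else theta_coeff a n (k - 1)) - (a + real k) * theta_coeff a n k"

lemma theta_coeff_eq_0: "n < k \<Longrightarrow> theta_coeff a n k = 0"
proof (induction n arbitrary: k)
  case (Suc n)
  then have "n < k" "n < k - 1" by auto
  then show ?case using Suc.IH by (simp only: theta_coeff.simps) simp
qed simp

text \<open>The recursion with the action moved from the coefficients to the summands.
  \<open>H\<close> is arbitrary because it will stand both for convolutions and for Gamma
  values.\<close>

lemma sum_theta_coeff_Suc:
  "(\<Sum>k\<le>Suc n. theta_coeff a (Suc n) k * H k) =
    (\<Sum>k\<le>n. theta_coeff a n k * (H (Suc k) - (a + real k) * H k))"
proof -
  have "(\<Sum>k\<le>Suc n. theta_coeff a (Suc n) k * H k) =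
      (\<Sum>k\<le>Suc n. (if k = 0 then 0 else theta_coeff a n (k - 1)) * H k)
      - (\<Sum>k\<le>Suc n. theta_coeff a n k * ((a + real k) * H k))"
    by (simp add: sum_subtractf[symmetric] algebra_simps del: sum.atMost_Suc)
  also have "(\<Sum>k\<le>Suc n. (if k = 0 then 0 else theta_coeff a n (k - 1)) * H k) =
      (\<Sum>k\<le>n. theta_coeff a n k * H (Suc k))"
    by (subst sum.atMost_Suc_shift) simp
  also have "(\<Sum>k\<le>Suc n. theta_coeff a n k * ((a + real k) * H k)) =
      (\<Sum>k\<le>n. theta_coeff a n k * ((a + real k) * H k))"
    by (simp add: theta_coeff_eq_0)
  finally show ?thesis by (simp add: sum_subtractf right_diff_distrib)
qed

text \<open>In \<open>Gamma (y + 1) = y * Gamma y\<close> the part \<open>a + k\<close> cancels, so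
  each application of \<theta> leaves just the factor \<open>m + 1\<close>.\<close>

lemma sum_theta_coeff_Gamma:
  assumes "m + a > - 1"
  shows "(\<Sum>k\<le>n. theta_coeff a n k * Gamma (m + a + real k + 1)) = (m + 1) ^ n * Gamma (m + a + 1)"
proof (induction n)
  case (Suc n)
  have "Gamma (m + a + real (Suc k) + 1) - (a + real k) * Gamma (m + a + real k + 1) =
      (m + 1) * Gamma (m + a + real k + 1)" for k
  proof -
    have "Gamma (m + a + real k + 1 + 1) = (m + a + real k + 1) * Gamma (m + a + real k + 1)"
      by (rule Gamma_plus1) (use assms in auto)
    then show ?thesis by (simp add: algebra_simps)
  qed
  then have "(\<Sum>k\<le>Suc n. theta_coeff a (Suc n) k * Gamma (m + a + real k + 1)) =
      (\<Sum>k\<le>n. theta_coeff a n k * ((m + 1) * Gamma (m + a + real k + 1)))"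
    by (subst sum_theta_coeff_Suc) (simp only:)
  also have "\<dots> = (m + 1) * ((m + 1) ^ n * Gamma (m + a + 1))"
    unfolding Suc[symmetric] by (simp add: sum_distrib_left mult.left_commute)
  finally show ?case by simp
qed simp

context
  fixes f :: "real \<Rightarrow> real" and m0 :: real
  assumes f_borel [measurable]: "f \<in> borel_measurable borel"
    and f_moments: "\<And>m. m \<ge> m0 \<Longrightarrow> \<exists>v. has_moment f m v"
begin

text \<open>The integrand of $(f * \mathcal G_{c-1})(x)$ without the factor $x^{c-1}$; differentiation in
  \<open>x\<close> then just raises \<open>c\<close> by one and changes the sign.\<close>

definition exp_kernel :: "real \<Rightarrow> real \<Rightarrow> real \<Rightarrow> real" where
  "exp_kernel c x u = indicator {0<..} u * (f u * u powr (- c) * exp (- (x / u)))"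

text \<open>Near zero the exponential beats every negative power of \<open>u\<close>, so a multiple
  of some existing moment integrand dominates the kernel.\<close>

lemma integrable_exp_kernel:
  assumes x: "x > 0"
  shows "integrable lborel (exp_kernel c x)"
proof -
  \<comment> \<open>\<open>m \<ge> m0\<close> makes the moment exist; \<open>m \<ge> 1 - c\<close>
    makes \<open>p = c + m\<close> positive, as the bound at \<open>v = 1 / u\<close>
    requires.\<close>
  define m where "m = max m0 (1 - c)"
  obtain v where "has_moment f m v" using f_moments[of m] by (auto simp: m_def)
  then have int: "integrable lborel (\<lambda>u. indicator {0<..} u * (u powr m * f u))"
    by (auto simp: has_moment_def has_bochner_integral_iff)
  define p where "p = c + m"
  have p: "p > 0" by (auto simp: p_def m_def)
  define C where "C = exp (p * ln (p / x) - p)"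
  have "integrable lborel (\<lambda>u. C * (indicator {0<..} u * (u powr m * f u)))"
    using int by simp
  then show ?thesis
  proof (rule Bochner_Integration.integrable_bound)
    show "exp_kernel c x \<in> borel_measurable lborel" unfolding exp_kernel_def[abs_def] by measurable
    show "AE u in lborel. norm (exp_kernel c x u) \<le> norm (C * (indicator {0<..} u * (u powr m * f u)))"
    proof (rule AE_I2)
      fix u :: real
      show "norm (exp_kernel c x u) \<le> norm (C * (indicator {0<..} u * (u powr m * f u)))"
      proof (cases "u > 0")
        case True
        have "(1 / u) powr p * exp (- (x * (1 / u))) \<le> C"
          unfolding C_def by (rule powr_times_exp_le) (use p x True in auto)
        moreover have "u powr (- c) = u powr m * (1 / u) powr p"
          using True by (simp add: p_def powr_divide powr_add powr_minus field_simps)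
        ultimately have "u powr (- c) * exp (- (x / u)) \<le> u powr m * C"
          by (simp add: mult.assoc mult_left_mono)
        then have "\<bar>f u\<bar> * (u powr (- c) * exp (- (x / u))) \<le> \<bar>f u\<bar> * (u powr m * C)"
          by (rule mult_left_mono) simp
        moreover have "C > 0" by (simp add: C_def)
        ultimately show ?thesis using True by (simp add: exp_kernel_def abs_mult ac_simps)
      qed (simp add: exp_kernel_def)
    qed
  qed
qed

text \<open>Half of the exponential decay pays for the Taylor remainder, which moves the majorant to
  \<open>x / 2\<close> and makes it depend on \<open>h\<close> only through
  \<open>h\<^sup>2\<close>. The factor \<open>(1 / u)\<^sup>2\<close> raises \<open>c\<close> by
  two.\<close>

lemma exp_kernel_remainder_le:
  assumes x: "x > 0" and h: "\<bar>h\<bar> < x / 2"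
  shows "\<bar>exp_kernel c (x + h) u - exp_kernel c x u + h * exp_kernel (c + 1) x u\<bar>
    \<le> h\<^sup>2 * \<bar>exp_kernel (c + 2) (x / 2) u\<bar>"
proof (cases "u > 0")
  case True
  have e1: "exp (- ((x + h) / u)) = exp (- (x / u)) * exp (- (h / u))"
    by (simp add: exp_add[symmetric] add_divide_distrib)
  have e2: "u powr (- (c + 1)) = u powr (- c) * (1 / u)"
    using True by (simp add: powr_diff powr_minus divide_simps)
  have e3: "u powr (- (c + 2)) = u powr (- c) * (1 / u)\<^sup>2"
    using True powr_diff[of u "- c" 2] by (simp add: power_one_over)
  have "exp_kernel c (x + h) u - exp_kernel c x u + h * exp_kernel (c + 1) x u =
     f u * u powr (- c) * exp (- (x / u)) * (exp (- (h / u)) - 1 + h / u)"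
    unfolding exp_kernel_def e1 e2 using True by (simp add: algebra_simps)
  then have "\<bar>exp_kernel c (x + h) u - exp_kernel c x u + h * exp_kernel (c + 1) x u\<bar> =
     \<bar>f u\<bar> * u powr (- c) * exp (- (x / u)) * \<bar>exp (- (h / u)) - 1 + h / u\<bar>"
    by (simp add: abs_mult)
  also have "\<dots> \<le> \<bar>f u\<bar> * u powr (- c) * exp (- (x / u)) * ((h / u)\<^sup>2 * exp \<bar>h / u\<bar>)"
    by (intro mult_left_mono exp_minus_remainder_le) auto
  also have "\<dots> = \<bar>f u\<bar> * u powr (- c) * (h / u)\<^sup>2 * exp (- (x / u) + \<bar>h / u\<bar>)"
    by (simp only: exp_add mult_ac)
  also have "\<dots> \<le> \<bar>f u\<bar> * u powr (- c) * (h / u)\<^sup>2 * exp (- (x / 2 / u))"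
  proof -
    have "\<bar>h / u\<bar> \<le> x / 2 / u" using h True divide_right_mono[of "\<bar>h\<bar>" "x / 2" u] by simp
    then have "- (x / u) + \<bar>h / u\<bar> \<le> - (x / 2 / u)" by (simp add: field_simps)
    then show ?thesis by (intro mult_left_mono) auto
  qed
  also have "\<dots> = h\<^sup>2 * \<bar>exp_kernel (c + 2) (x / 2) u\<bar>"
    unfolding exp_kernel_def e3 using True by (simp add: abs_mult power_divide)
  finally show ?thesis .
qed (simp add: exp_kernel_def)

lemma DERIV_exp_kernel_integral:
  assumes x: "x > 0"
  shows "((\<lambda>x. \<integral>u. exp_kernel c x u \<partial>lborel) has_real_derivative
    - (\<integral>u. exp_kernel (c + 1) x u \<partial>lborel)) (at x)"
proof (rule DERIV_quadratic_remainder[where d = "x / 2"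
      and B = "\<integral>u. \<bar>exp_kernel (c + 2) (x / 2) u\<bar> \<partial>lborel"])
  fix h assume h: "\<bar>h\<bar> < x / 2"
  then have xh: "x + h > 0" using x by linarith
  have i: "integrable lborel (exp_kernel c (x + h))" "integrable lborel (exp_kernel c x)"
    "integrable lborel (exp_kernel (c + 1) x)" "integrable lborel (exp_kernel (c + 2) (x / 2))"
    using x xh by (auto intro!: integrable_exp_kernel)
  let ?R = "\<lambda>u. exp_kernel c (x + h) u - exp_kernel c x u + h * exp_kernel (c + 1) x u"
  let ?Q = "exp_kernel (c + 2) (x / 2)"
  have iR: "integrable lborel (\<lambda>u. \<bar>?R u\<bar>)"
    by (intro integrable_abs Bochner_Integration.integrable_add Bochner_Integration.integrable_diff
        integrable_mult_right i)
  have iQ: "integrable lborel (\<lambda>u. h\<^sup>2 * \<bar>?Q u\<bar>)"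
    by (intro integrable_abs integrable_mult_right i)
  have "(\<integral>u. exp_kernel c (x + h) u \<partial>lborel) - (\<integral>u. exp_kernel c x u \<partial>lborel)
      - h * - (\<integral>u. exp_kernel (c + 1) x u \<partial>lborel) = (\<integral>u. ?R u \<partial>lborel)"
    using i by simp
  moreover have "\<bar>\<integral>u. ?R u \<partial>lborel\<bar> \<le> (\<integral>u. \<bar>?R u\<bar> \<partial>lborel)"
    by (rule integral_abs_bound)
  moreover have "(\<integral>u. \<bar>?R u\<bar> \<partial>lborel) \<le> (\<integral>u. h\<^sup>2 * \<bar>?Q u\<bar> \<partial>lborel)"
    using exp_kernel_remainder_le[OF x h] by (intro integral_mono iR iQ)
  moreover have "(\<integral>u. h\<^sup>2 * \<bar>?Q u\<bar> \<partial>lborel) = (\<integral>u. \<bar>?Q u\<bar> \<partial>lborel) * h\<^sup>2"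
    by (subst integral_mult_right_zero) (rule mult.commute)
  ultimately show "\<bar>(\<integral>u. exp_kernel c (x + h) u \<partial>lborel) - (\<integral>u. exp_kernel c x u \<partial>lborel)
      - h * - (\<integral>u. exp_kernel (c + 1) x u \<partial>lborel)\<bar> \<le> (\<integral>u. \<bar>?Q u\<bar> \<partial>lborel) * h\<^sup>2"
    by linarith
qed (use x in auto)

lemma mellin_conv_gamma_weight:
  assumes "x > 0"
  shows "mellin_conv f (gamma_weight a) x = x powr a * (\<integral>u. exp_kernel (a + 1) x u \<partial>lborel)"
proof -
  have "indicator {0<..} u *\<^sub>R (f u * gamma_weight a (x / u) / u) = x powr a * exp_kernel (a + 1) x u" for u
    using assms
    by (cases "u > 0") (auto simp: gamma_weight_def exp_kernel_def powr_divide powr_diff powr_minus field_simps)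
  then show ?thesis by (simp only: mellin_conv_def set_lebesgue_integral_def integral_mult_right_zero)
qed

text \<open>The derivative is arranged so that multiplication by \<open>- x\<close> gives the rule
  for \<theta> on Gamma weights.\<close>

lemma DERIV_mellin_conv_gamma_weight:
  assumes x: "x > 0"
  shows "(mellin_conv f (gamma_weight a) has_real_derivative
    - (mellin_conv f (gamma_weight (a + 1)) x - a * mellin_conv f (gamma_weight a) x) / x) (at x)"
proof (rule has_field_derivative_transform_within_open[where S = "{0<..}"])
  have "((\<lambda>x. x powr a * (\<integral>u. exp_kernel (a + 1) x u \<partial>lborel)) has_real_derivative
    a * x powr (a - 1) * (\<integral>u. exp_kernel (a + 1) x u \<partial>lborel) +
    - (\<integral>u. exp_kernel (a + 1 + 1) x u \<partial>lborel) * x powr a) (at x)"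
    by (intro DERIV_mult DERIV_exp_kernel_integral has_real_derivative_powr x)
  moreover have "a * x powr (a - 1) * (\<integral>u. exp_kernel (a + 1) x u \<partial>lborel) +
    - (\<integral>u. exp_kernel (a + 1 + 1) x u \<partial>lborel) * x powr a =
    - (mellin_conv f (gamma_weight (a + 1)) x - a * mellin_conv f (gamma_weight a) x) / x"
    unfolding mellin_conv_gamma_weight[OF x] using x
    by (simp add: powr_diff powr_add field_simps)
  ultimately show "((\<lambda>x. x powr a * (\<integral>u. exp_kernel (a + 1) x u \<partial>lborel)) has_real_derivative
    - (mellin_conv f (gamma_weight (a + 1)) x - a * mellin_conv f (gamma_weight a) x) / x) (at x)"
    by simp
qed (use x in \<open>auto simp: mellin_conv_gamma_weight\<close>)

lemma theta_power_mellin_conv_gamma_weight: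
  assumes "x > 0"
  shows "((\<lambda>f x. - x * deriv f x) ^^ n) (mellin_conv f (gamma_weight a)) x =
    (\<Sum>k\<le>n. theta_coeff a n k * mellin_conv f (gamma_weight (a + real k)) x)"
  using assms
proof (induction n arbitrary: x)
  case (Suc n)
  let ?\<theta> = "\<lambda>f x. - x * deriv f x :: real"
  let ?h = "\<lambda>k. mellin_conv f (gamma_weight (a + real k))"
  let ?D = "\<Sum>k\<le>n. theta_coeff a n k * (- (?h (Suc k) x - (a + real k) * ?h k x) / x)"
  have D: "(?h k has_real_derivative - (?h (Suc k) x - (a + real k) * ?h k x) / x) (at x)" for k
    using DERIV_mellin_conv_gamma_weight[OF Suc.prems, of "a + real k"]
    by (simp add: add_ac)
  have "((\<lambda>x. \<Sum>k\<le>n. theta_coeff a n k * ?h k x) has_real_derivative ?D) (at x)"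
    by (intro DERIV_sum DERIV_cmult D)
  \<comment> \<open>The induction hypothesis holds on the whole open half-line, not just at
    \<open>x\<close>, which permits differentiating it.\<close>
  then have "((?\<theta> ^^ n) (mellin_conv f (gamma_weight a)) has_real_derivative ?D) (at x)"
    by (rule has_field_derivative_transform_within_open[where S = "{0<..}"])
      (use Suc in auto)
  then have "(?\<theta> ^^ Suc n) (mellin_conv f (gamma_weight a)) x = - x * ?D"
    by (simp add: DERIV_imp_deriv)
  also have "\<dots> = (\<Sum>k\<le>n. theta_coeff a n k * (?h (Suc k) x - (a + real k) * ?h k x))"
  proof -
    have "- x * (c * (- d / x)) = c * d" for c d :: real using Suc.prems by simp
    then show ?thesis by (simp only: sum_distrib_left)
  qed
  also have "\<dots> = (\<Sum>k\<le>Suc n. theta_coeff a (Suc n) k * ?h k x)"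
    by (rule sum_theta_coeff_Suc[symmetric])
  finally show ?case .
qed simp

text \<open>Moments of the expanded sum are taken term by term, so no boundary terms arise.\<close>

lemma has_moment_theta_power:
  assumes f: "has_moment f m v" and "m + a > - 1"
  shows "has_moment (((\<lambda>f x. - x * deriv f x) ^^ n) (mellin_conv f (gamma_weight a))) m
    ((m + 1) ^ n * (v * Gamma (m + a + 1)))"
proof -
  have "has_moment (\<lambda>x. \<Sum>k\<le>n. theta_coeff a n k * mellin_conv f (gamma_weight (a + real k)) x) m
      (\<Sum>k\<le>n. theta_coeff a n k * (v * Gamma (m + (a + real k) + 1)))"
    by (intro has_moment_sum has_moment_cmult has_moment_mellin_conv f_borel f
        borel_measurable_gamma_weight has_moment_gamma_weight) (use assms in auto)
  also have "(\<Sum>k\<le>n. theta_coeff a n k * (v * Gamma (m + (a + real k) + 1))) =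
      v * (\<Sum>k\<le>n. theta_coeff a n k * Gamma (m + a + real k + 1))"
    by (simp add: sum_distrib_left ac_simps)
  also have "\<dots> = (m + 1) ^ n * (v * Gamma (m + a + 1))"
    using sum_theta_coeff_Gamma[OF assms(2)] by simp
  finally show ?thesis
    by (rule has_moment_cong[THEN iffD2, rotated]) (rule theta_power_mellin_conv_gamma_weight)
qed

end

section \<open>Moments of the two vectors of weights\<close>

lemma divided_difference_remove_point:
  fixes e g :: "nat \<Rightarrow> real"
  assumes "finite A" "p \<in> A" "inj_on e A"
  shows "(\<Sum>l\<in>A. g l * (e l - e p) / (\<Prod>h\<in>A - {l}. e l - e h)) =
    (\<Sum>l\<in>A - {p}. g l / (\<Prod>h\<in>A - {p} - {l}. e l - e h))"
proof -
  \<comment> \<open>The extra factor cancels the node \<open>p\<close> from the product; at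
    \<open>l = p\<close> it kills the term.\<close>
  have "g l * (e l - e p) / (\<Prod>h\<in>A - {l}. e l - e h) = g l / (\<Prod>h\<in>A - {p} - {l}. e l - e h)"
    if l: "l \<in> A - {p}" for l
  proof -
    have "(\<Prod>h\<in>A - {l}. e l - e h) = (e l - e p) * (\<Prod>h\<in>A - {l} - {p}. e l - e h)"
      using assms l by (intro prod.remove) auto
    moreover have "A - {l} - {p} = A - {p} - {l}" by auto
    moreover have "e l - e p \<noteq> 0" using assms l by (auto dest: inj_onD)
    ultimately show ?thesis by simp
  qed
  then show ?thesis using assms by (subst sum.remove[of A p]) auto
qed

text \<open>The divided difference of $x \mapsto 1/(y + z x)$ at the nodes \<open>e l\<close>.\<close>

lemma divided_difference_reciprocal:
  fixes e :: "nat \<Rightarrow> real"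
  assumes "card A = Suc n" "inj_on e A" "\<And>l. l \<in> A \<Longrightarrow> y + z * e l \<noteq> 0"
  shows "(\<Sum>l\<in>A. 1 / (y + z * e l) / (\<Prod>h\<in>A - {l}. e l - e h)) = (- z) ^ n / (\<Prod>h\<in>A. y + z * e h)"
  using assms
proof (induction n arbitrary: A)
  case 0
  then obtain x where "A = {x}" by (auto simp: card_Suc_eq)
  then show ?case by simp
next
  case (Suc n)
  have fin: "finite A" using Suc.prems by (intro card_ge_0_finite) simp
  obtain p q where pq: "p \<in> A" "q \<in> A" "p \<noteq> q"
    using Suc.prems(1) by (metis card_Suc_eq insertI1 insertI2)
  let ?g = "\<lambda>l. 1 / (y + z * e l)"
  let ?D = "\<lambda>A. \<Sum>l\<in>A. ?g l / (\<Prod>h\<in>A - {l}. e l - e h)"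
  let ?P = "\<Prod>h\<in>A. y + z * e h"
  have ne: "e q - e p \<noteq> 0" using pq Suc.prems by (auto dest: inj_onD)
  have IH: "?D (A - {p}) = (- z) ^ n * (y + z * e p) / ?P" if "p \<in> A" for p
  proof -
    have "?D (A - {p}) = (- z) ^ n / (\<Prod>h\<in>A - {p}. y + z * e h)"
      by (rule Suc.IH) (use Suc.prems fin that in \<open>auto intro: inj_on_subset\<close>)
    moreover have "?P = (y + z * e p) * (\<Prod>h\<in>A - {p}. y + z * e h)"
      by (rule prod.remove[OF fin that])
    ultimately show ?thesis using Suc.prems(3)[OF that] by simp
  qed
  \<comment> \<open>The classical recursion: under the sum, \<open>e q - e p\<close> is written as
    \<open>(e l - e p) - (e l - e q)\<close>, and each part loses one node.\<close>
  have "?D A * (e q - e p) =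
      (\<Sum>l\<in>A. ?g l * (e l - e p) / (\<Prod>h\<in>A - {l}. e l - e h))
      - (\<Sum>l\<in>A. ?g l * (e l - e q) / (\<Prod>h\<in>A - {l}. e l - e h))"
    unfolding sum_subtractf[symmetric] sum_distrib_right
    by (intro sum.cong refl) (simp add: diff_divide_distrib[symmetric] algebra_simps)
  also have "\<dots> = ?D (A - {p}) - ?D (A - {q})"
    by (simp only: divided_difference_remove_point[OF fin pq(1) Suc.prems(2), of ?g]
        divided_difference_remove_point[OF fin pq(2) Suc.prems(2), of ?g])
  also have "\<dots> = (- z) ^ Suc n / ?P * (e q - e p)"
    unfolding IH[OF pq(1)] IH[OF pq(2)]
    by (simp add: algebra_simps add_divide_distrib diff_divide_distrib)
  finally show ?case by (rule mult_right_cancel[OF ne, THEN iffD1])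
qed

section \<open>Moments of the Laguerre weights\<close>

definition lag_weight :: "nat \<Rightarrow> (nat \<Rightarrow> real) \<Rightarrow> (nat \<Rightarrow> real) \<Rightarrow> nat \<Rightarrow> real \<Rightarrow> real" where
  "lag_weight r a b j = (if j \<le> r then beta_weight (a j) (b j) else gamma_weight (a j))"

definition lag_factor :: "nat \<Rightarrow> (nat \<Rightarrow> real) \<Rightarrow> (nat \<Rightarrow> real) \<Rightarrow> real \<Rightarrow> nat \<Rightarrow> real" where
  "lag_factor r a b m j =
     (if j \<le> r then Gamma (m + a j + 1) / Gamma (m + b j + 1) else Gamma (m + a j + 1))"

text \<open>The moment of \<open>laguerre_w0\<close>, which becomes the common factor of the moments
  on both the Laguerre and the Jacobi side.\<close>

definition lag_moment :: "nat \<Rightarrow> nat \<Rightarrow> (nat \<Rightarrow> real) \<Rightarrow> (nat \<Rightarrow> real) \<Rightarrow> real \<Rightarrow> real" where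
  "lag_moment r s a b m = (\<Prod>j=1..r + s. lag_factor r a b m j)"

lemma laguerre_w0_eq: "laguerre_w0 r s a b = mellin_convs (map (lag_weight r a b) [1..<r + s + 1])"
proof -
  have "map (lag_weight r a b) [1..<r + s + 1] =
      map (lag_weight r a b) [1..<r + 1] @ map (lag_weight r a b) [r + 1..<r + s + 1]"
    using upt_add_eq_append[of 1 "r + 1" s] by simp
  also have "\<dots> = map (\<lambda>h. beta_weight (a h) (b h)) [1..<r + 1] @
      map (\<lambda>j. gamma_weight (a j)) [r + 1..<r + s + 1]"
    by (auto simp: lag_weight_def)
  finally show ?thesis by (simp add: laguerre_w0_def)
qed

lemma borel_measurable_lag_weight: "lag_weight r a b j \<in> borel_measurable borel"
  by (simp add: lag_weight_def)

lemma has_moment_lag_weight: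
  assumes "m + a j > - 1" "j \<le> r \<Longrightarrow> a j < b j"
  shows "has_moment (lag_weight r a b j) m (lag_factor r a b m j)"
  using assms by (auto simp: lag_weight_def lag_factor_def
      intro!: has_moment_beta_weight has_moment_gamma_weight)

lemma prod_list_map_upt: "prod_list (map f [1..<n + 1]) = (\<Prod>j=1..n. f j)" for f :: "nat \<Rightarrow> real"
  using prod.distinct_set_conv_list[of "[1..<n + 1]" f]
  by (simp del: upt_Suc add: atLeastLessThanSuc_atLeastAtMost)

lemma has_moment_laguerre_w0:
  assumes "r + s \<ge> 1" "\<And>j. j \<in> {1..r + s} \<Longrightarrow> m + a j > - 1" "\<And>h. h \<in> {1..r} \<Longrightarrow> a h < b h"
  shows "has_moment (laguerre_w0 r s a b) m (lag_moment r s a b m)"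
  unfolding laguerre_w0_eq lag_moment_def prod_list_map_upt[symmetric]
  by (rule has_moment_mellin_convs)
    (use assms in \<open>auto intro!: has_moment_lag_weight borel_measurable_lag_weight\<close>)

text \<open>Raising one lower parameter alters a single Gamma quotient of the product; this isolates
  it.\<close>

lemma prod_cong_except:
  fixes f g :: "nat \<Rightarrow> real"
  assumes "h \<in> A" "finite A" "g h = f h * c" "\<And>j. j \<in> A \<Longrightarrow> j \<noteq> h \<Longrightarrow> g j = f j"
  shows "prod g A = prod f A * c"
proof -
  have "prod g (A - {h}) = prod f (A - {h})" using assms by (intro prod.cong) auto
  then show ?thesis using assms by (simp add: prod.remove[of A h])
qed

lemma Gamma_ratio_shift:
  fixes x y :: real
  assumes "y > 0"
  shows "Gamma x / Gamma (y + 1) = Gamma x / Gamma y * (1 / y)"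
proof -
  have "Gamma (y + 1) = y * Gamma y" by (rule Gamma_plus1) (use assms in auto)
  then show ?thesis by simp
qed

lemma has_moment_laguerre_w:
  assumes "\<And>j. j \<in> {1..r + s} \<Longrightarrow> m + a j > - 1" "\<And>h. h \<in> {1..r} \<Longrightarrow> a h < b h" "h \<in> {1..r}"
  shows "has_moment (laguerre_w r s a b h) m (lag_moment r s a b m * (1 / (m + b h + 1)))"
proof -
  have "has_moment (laguerre_w r s a b h) m (lag_moment r s a (b(h := b h + 1)) m)"
    unfolding laguerre_w_def
  proof (rule has_moment_laguerre_w0)
    show "a i < (b(h := b h + 1)) i" if "i \<in> {1..r}" for i
      using assms(2)[OF that] by (cases "i = h") auto
  qed (use assms in auto)
  moreover have "lag_moment r s a (b(h := b h + 1)) m = lag_moment r s a b m * (1 / (m + b h + 1))"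
    unfolding lag_moment_def
  proof (rule prod_cong_except)
    have "m + b h + 1 > 0" using assms(1)[of h] assms(2,3) by fastforce
    from Gamma_ratio_shift[OF this]
    show "lag_factor r a (b(h := b h + 1)) m h = lag_factor r a b m h * (1 / (m + b h + 1))"
      using assms(3) by (simp add: lag_factor_def add_ac)
  qed (use assms in \<open>auto simp: lag_factor_def\<close>)
  ultimately show ?thesis by simp
qed

lemma has_moment_laguerre_v:
  assumes a: "\<And>j. j \<in> {1..r + s} \<Longrightarrow> m + a j > - 1" and b: "\<And>h. h \<in> {1..r} \<Longrightarrow> a h < b h"
    and l: "l \<in> {1..s}"
  shows "has_moment (laguerre_v r s a b l) m (lag_moment r s a b m * (m + 1) ^ (l - 1))"
\<comment> \<open>Without derivatives the case is separate, because for \<open>r + s = 1\<close>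
  there is no convolution to split; \<open>l \<ge> 2\<close> forces \<open>r + s \<ge> 2\<close>,
  and the last weight is then a Gamma weight.\<close>
proof (cases "l = 1")
  case True
  have "has_moment (laguerre_w0 r s a b) m (lag_moment r s a b m)"
    by (rule has_moment_laguerre_w0) (use l a b in auto)
  then show ?thesis using True by (simp add: laguerre_v_def)
next
  case False
  define xs where "xs = [1..<r + s]"
  have xs: "xs \<noteq> []" using l False by (auto simp: xs_def)
  have sp: "[1..<r + s + 1] = xs @ [r + s]" using l by (simp add: xs_def)
  let ?f = "mellin_convs (map (lag_weight r a b) xs)"
  have last: "lag_weight r a b (r + s) = gamma_weight (a (r + s))"
    "lag_factor r a b m (r + s) = Gamma (m + a (r + s) + 1)"
    using l by (auto simp: lag_weight_def lag_factor_def)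
  have w0: "laguerre_w0 r s a b = mellin_conv ?f (gamma_weight (a (r + s)))"
    unfolding laguerre_w0_eq sp using xs by (simp add: mellin_convs_snoc last)
  have f: "has_moment ?f m' (prod_list (map (lag_factor r a b m') xs))" if "m' \<ge> m" for m'
  proof (rule has_moment_mellin_convs[OF xs])
    fix j assume "j \<in> set xs"
    then have j: "j \<in> {1..r + s}" by (auto simp: xs_def)
    then show "has_moment (lag_weight r a b j) m' (lag_factor r a b m' j)"
      using a[OF j] b that by (intro has_moment_lag_weight) auto
  qed (rule borel_measurable_lag_weight)
  have fb: "?f \<in> borel_measurable borel"
    using xs by (intro borel_measurable_mellin_convs) (auto intro: borel_measurable_lag_weight)
  have "has_moment (laguerre_v r s a b l) m
      ((m + 1) ^ (l - 1) * (prod_list (map (lag_factor r a b m) xs) * Gamma (m + a (r + s) + 1)))"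
    unfolding laguerre_v_def w0
    by (rule has_moment_theta_power[where m0 = m]) (use fb f a l in auto)
  also have "prod_list (map (lag_factor r a b m) xs) * Gamma (m + a (r + s) + 1) = lag_moment r s a b m"
    unfolding lag_moment_def prod_list_map_upt[symmetric] sp using last by simp
  finally show ?thesis by (simp add: mult.commute)
qed

text \<open>The factor by which the moments of the scaled Jacobi weights differ from those of the Laguerre
  weights, up to a rational function of the parameters.\<close>

definition gamma_ratio ::
    "nat \<Rightarrow> nat \<Rightarrow> (nat \<Rightarrow> real) \<Rightarrow> (nat \<Rightarrow> real) \<Rightarrow> real \<Rightarrow> real \<Rightarrow> real" where
  "gamma_ratio r s a \<omega> m t = (\<Prod>l=1..s. kappa r a \<omega> t l powr (m + a (r + l) + 1) *
     Gamma (kappa r a \<omega> t l + 1) / Gamma (kappa r a \<omega> t l + 1 + (m + a (r + l) + 1)))"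

section \<open>Moments of the scaled and transformed Jacobi weights\<close>

lemma gamma_ratio_tendsto:
  assumes "\<And>j. j \<in> {1..r + s} \<Longrightarrow> m + a j > - 1" "\<And>l. l \<in> {1..s} \<Longrightarrow> \<omega> l > 0"
  shows "((\<lambda>t. gamma_ratio r s a \<omega> m t) \<longlongrightarrow> 1) at_top"
proof -
  have "((\<lambda>t. gamma_ratio r s a \<omega> m t) \<longlongrightarrow> (\<Prod>l=1..s. 1)) at_top"
    unfolding gamma_ratio_def
  proof (rule tendsto_prod)
    fix l assume l: "l \<in> {1..s}"
    have w: "\<omega> l > 0" using assms(2) l by simp
    have "filterlim (\<lambda>t. kappa r a \<omega> t l) at_top at_top"
      unfolding kappa_def using w by real_asymp
    moreover have "0 \<le> m + a (r + l) + 1" using assms(1)[of "r + l"] l by simp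
    ultimately show "((\<lambda>t. kappa r a \<omega> t l powr (m + a (r + l) + 1) * Gamma (kappa r a \<omega> t l + 1) /
        Gamma (kappa r a \<omega> t l + 1 + (m + a (r + l) + 1))) \<longlongrightarrow> 1) at_top"
      using filterlim_compose[OF Gamma_ratio_tendsto_1] by blast
  qed
  then show ?thesis by simp
qed

text \<open>Put \<open>y = m + a (r + l) + 1\<close>. \<open>c_scale\<close> supplies the power
  \<open>m + 1\<close> and \<open>d_scale\<close> the rest of
  \<open>kappa powr y * Gamma (kappa + 1)\<close>; the shift in \<open>kappa\<close> makes
  \<open>m + t * \<omega> l + 1\<close> equal to \<open>kappa + 1 + y\<close>.\<close>

lemma scale_product_eq:
  assumes "\<And>l. l \<in> {1..s} \<Longrightarrow> kappa r a \<omega> t l > 0"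
  shows "d_scale r s a \<omega> t * c_scale r s a \<omega> t powr (m + 1) *
      (\<Prod>i=1..r + s. Gamma (m + a i + 1) / Gamma (m + jacobi_b r b \<omega> t i + 1)) =
    lag_moment r s a b m * gamma_ratio r s a \<omega> m t"
proof -
  have split: "(\<Prod>i=1..r + s. F i) = (\<Prod>i=1..r. F i) * (\<Prod>l=1..s. F (r + l))" for F :: "nat \<Rightarrow> real"
  proof -
    have "(\<Prod>i=1..r + s. F i) = (\<Prod>i=1..r. F i) * (\<Prod>i=r + 1..r + s. F i)"
      using prod.ub_add_nat[of 1 r F s] by simp
    also have "(\<Prod>i=r + 1..r + s. F i) = (\<Prod>l=1..s. F (r + l))"
      using prod.shift_bounds_cl_nat_ivl[of F 1 r s] by (simp add: add.commute)
    finally show ?thesis .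
  qed
  have c: "c_scale r s a \<omega> t powr (m + 1) = (\<Prod>l=1..s. kappa r a \<omega> t l powr (m + 1))"
    unfolding c_scale_def using assms by (intro prod_powr_distrib)
  have "(\<Prod>l=1..s. kappa r a \<omega> t l powr a (r + l) * Gamma (kappa r a \<omega> t l + 1)) *
      (\<Prod>l=1..s. kappa r a \<omega> t l powr (m + 1)) *
      (\<Prod>l=1..s. Gamma (m + a (r + l) + 1) / Gamma (m + jacobi_b r b \<omega> t (r + l) + 1)) =
    (\<Prod>l=1..s. lag_factor r a b m (r + l)) * gamma_ratio r s a \<omega> m t"
    unfolding gamma_ratio_def prod.distrib[symmetric]
  proof (rule prod.cong[OF refl])
    fix l assume l: "l \<in> {1..s}"
    have lf: "lag_factor r a b m (r + l) = Gamma (m + a (r + l) + 1)"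
      using l by (simp add: lag_factor_def)
    have "m + jacobi_b r b \<omega> t (r + l) + 1 = kappa r a \<omega> t l + 1 + (m + a (r + l) + 1)"
      using l by (simp add: jacobi_b_def kappa_def)
    moreover have "kappa r a \<omega> t l powr (m + a (r + l) + 1) =
        kappa r a \<omega> t l powr a (r + l) * kappa r a \<omega> t l powr (m + 1)"
      by (simp add: powr_add[symmetric] add_ac)
    ultimately show "kappa r a \<omega> t l powr a (r + l) * Gamma (kappa r a \<omega> t l + 1) * kappa r a \<omega> t l powr (m + 1) *
        (Gamma (m + a (r + l) + 1) / Gamma (m + jacobi_b r b \<omega> t (r + l) + 1)) =
      lag_factor r a b m (r + l) * (kappa r a \<omega> t l powr (m + a (r + l) + 1) * Gamma (kappa r a \<omega> t l + 1) /
        Gamma (kappa r a \<omega> t l + 1 + (m + a (r + l) + 1)))"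
      by (simp only: lf times_divide_eq_right times_divide_eq_left mult_ac)
  qed
  moreover have "(\<Prod>i=1..r. Gamma (m + a i + 1) / Gamma (m + jacobi_b r b \<omega> t i + 1)) =
      (\<Prod>i=1..r. lag_factor r a b m i)"
    by (intro prod.cong) (auto simp: lag_factor_def jacobi_b_def)
  ultimately show ?thesis
    unfolding split c d_scale_def lag_moment_def by (simp only: mult_ac)
qed

lemma has_moment_scaled_jacobi:
  assumes a: "\<And>j. j \<in> {1..r + s} \<Longrightarrow> m + a j > - 1" and b: "\<And>h. h \<in> {1..r} \<Longrightarrow> a h < b h"
    and kappa: "\<And>l. l \<in> {1..s} \<Longrightarrow> kappa r a \<omega> t l > 0" and j: "j \<in> {1..r + s}"
  shows "has_moment (scaled_jacobi r s a b \<omega> t j) m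
    (lag_moment r s a b m * gamma_ratio r s a \<omega> m t * (1 / (m + jacobi_b r b \<omega> t j + 1)))"
proof -
  let ?b = "jacobi_b r b \<omega> t"
  let ?b' = "?b(j := ?b j + 1)"
  \<comment> \<open>Positivity of \<open>kappa\<close> means
    \<open>t * \<omega> l > a (r + l) + 1\<close>, so the Beta weights with moving parameter are
    admissible.\<close>
  have ab: "a i < ?b i" if "i \<in> {1..r + s}" for i
  proof (cases "i \<le> r")
    case False
    then have "i - r \<in> {1..s}" using that by auto
    then have "kappa r a \<omega> t (i - r) > 0" by (rule kappa)
    then show ?thesis using False by (simp add: jacobi_b_def kappa_def)
  qed (use b that in \<open>auto simp: jacobi_b_def\<close>)
  have c: "c_scale r s a \<omega> t > 0"
    unfolding c_scale_def by (rule prod_pos) (use kappa in auto)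
  have "has_moment (jacobi_w (r + s) a ?b j) m
      (prod_list (map (\<lambda>i. Gamma (m + a i + 1) / Gamma (m + ?b' i + 1)) [1..<r + s + 1]))"
    unfolding jacobi_w_def
  proof (rule has_moment_mellin_convs)
    fix i assume "i \<in> set [1..<r + s + 1]"
    then have "i \<in> {1..r + s}" by auto
    then show "has_moment (beta_weight (a i) (?b' i)) m (Gamma (m + a i + 1) / Gamma (m + ?b' i + 1))"
      using a ab[of i] by (intro has_moment_beta_weight) (auto intro: less_trans)
  qed (use j in \<open>auto intro: borel_measurable_beta_weight\<close>)
  also have "prod_list (map (\<lambda>i. Gamma (m + a i + 1) / Gamma (m + ?b' i + 1)) [1..<r + s + 1]) =
      (\<Prod>i=1..r + s. Gamma (m + a i + 1) / Gamma (m + ?b i + 1)) * (1 / (m + ?b j + 1))"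
    unfolding prod_list_map_upt
  proof (rule prod_cong_except[OF j])
    have "m + ?b j + 1 > 0" using a[OF j] ab[OF j] by linarith
    from Gamma_ratio_shift[OF this]
    show "Gamma (m + a j + 1) / Gamma (m + ?b' j + 1) =
        Gamma (m + a j + 1) / Gamma (m + ?b j + 1) * (1 / (m + ?b j + 1))"
      by (simp add: add_ac)
  qed auto
  finally have "has_moment (scaled_jacobi r s a b \<omega> t j) m
      (d_scale r s a \<omega> t * (c_scale r s a \<omega> t powr (m + 1) *
        ((\<Prod>i=1..r + s. Gamma (m + a i + 1) / Gamma (m + ?b i + 1)) * (1 / (m + ?b j + 1)))))"
    unfolding scaled_jacobi_def by (intro has_moment_cmult has_moment_scale c)
  then show ?thesis by (simp only: scale_product_eq[OF kappa, of s, symmetric] mult.assoc)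
qed

text \<open>Since \<open>1 / (z + t * \<omega> l)\<close> is \<open>eps / (1 + z * eps)\<close>, the
  \<open>eps\<close> in the denominator of \<open>R_coeff\<close> cancels and a divided difference
  at the nodes \<open>eps\<close> remains. The sign in \<open>R_coeff\<close> turns
  \<open>(- z) ^ (k - 1)\<close> into \<open>z ^ (k - 1)\<close>.\<close>

lemma sum_R_coeff:
  assumes t: "t > 0" and \<omega>: "\<And>l. l \<in> {1..k} \<Longrightarrow> \<omega> l > 0" and inj: "inj_on \<omega> {1..k}"
    and z: "\<And>l. l \<in> {1..k} \<Longrightarrow> z + t * \<omega> l > 0" and k: "k \<ge> 1"
  shows "(\<Sum>l=1..k. R_coeff \<omega> t k l * (1 / (z + t * \<omega> l))) =
    z ^ (k - 1) / (\<Prod>l=1..k. 1 + z * eps \<omega> t l)"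
proof -
  let ?e = "eps \<omega> t"
  have e: "1 + z * ?e l = (z + t * \<omega> l) * ?e l" "?e l > 0" if "l \<in> {1..k}" for l
  proof -
    show "1 + z * ?e l = (z + t * \<omega> l) * ?e l" "?e l > 0"
      using t \<omega>[OF that] unfolding eps_def by (simp_all add: field_simps)
  qed
  have "(\<Sum>l=1..k. R_coeff \<omega> t k l * (1 / (z + t * \<omega> l))) =
      (\<Sum>l=1..k. (- 1) ^ (k - 1) * (1 / (1 + z * ?e l) / (\<Prod>h\<in>{1..k} - {l}. ?e l - ?e h)))"
    by (intro sum.cong refl) (simp add: R_coeff_def e)
  also have "\<dots> = (- 1) ^ (k - 1) * ((- z) ^ (k - 1) / (\<Prod>l=1..k. 1 + z * ?e l))"
    unfolding sum_distrib_left[symmetric]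
  proof (subst divided_difference_reciprocal)
    show "inj_on ?e {1..k}"
    proof (rule inj_onI)
      fix l h assume lh: "l \<in> {1..k}" "h \<in> {1..k}" and "?e l = ?e h"
      then have "t * \<omega> l = t * \<omega> h" unfolding eps_def by (simp only: inverse_eq_iff_eq)
      then have "\<omega> l = \<omega> h" using t by simp
      then show "l = h" using inj lh by (auto dest: inj_onD)
    qed
    show "1 + z * ?e l \<noteq> 0" if "l \<in> {1..k}" for l
      unfolding e(1)[OF that] using mult_pos_pos[OF z[OF that] e(2)[OF that]] by (rule less_imp_neq[symmetric])
  qed (use k in auto)
  also have "\<dots> = z ^ (k - 1) / (\<Prod>l=1..k. 1 + z * ?e l)"
    by (simp only: times_divide_eq_right power_mult_distrib[symmetric] minus_mult_minus mult_1_left)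
  finally show ?thesis .
qed

lemma has_moment_V_hat:
  assumes a: "\<And>j. j \<in> {1..r + s} \<Longrightarrow> m + a j > - 1" and b: "\<And>h. h \<in> {1..r} \<Longrightarrow> a h < b h"
    and kappa: "\<And>l. l \<in> {1..s} \<Longrightarrow> kappa r a \<omega> t l > 0" and t: "t > 0"
    and \<omega>: "\<And>l. l \<in> {1..s} \<Longrightarrow> \<omega> l > 0" and inj: "inj_on \<omega> {1..s}" and k: "k \<in> {1..s}"
  shows "has_moment (V_hat r s a b \<omega> t k) m
    (lag_moment r s a b m * gamma_ratio r s a \<omega> m t *
      ((m + 1) ^ (k - 1) / (\<Prod>l=1..k. 1 + (m + 1) * eps \<omega> t l)))"
proof -
  let ?C = "lag_moment r s a b m * gamma_ratio r s a \<omega> m t"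
  have "has_moment (V_hat r s a b \<omega> t k) m
      (\<Sum>l=1..k. R_coeff \<omega> t k l * (?C * (1 / (m + jacobi_b r b \<omega> t (r + l) + 1))))"
    unfolding V_hat_def
    by (intro has_moment_sum has_moment_cmult has_moment_scaled_jacobi a b kappa) (use k in auto)
  \<comment> \<open>The Gamma factors do not depend on \<open>l\<close>, so the linear combination
    acts on the rational factors alone.\<close>
  also have "(\<Sum>l=1..k. R_coeff \<omega> t k l * (?C * (1 / (m + jacobi_b r b \<omega> t (r + l) + 1)))) =
      ?C * (\<Sum>l=1..k. R_coeff \<omega> t k l * (1 / (m + 1 + t * \<omega> l)))"
    unfolding sum_distrib_left by (intro sum.cong) (auto simp: jacobi_b_def add_ac)
  also have "(\<Sum>l=1..k. R_coeff \<omega> t k l * (1 / (m + 1 + t * \<omega> l))) =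
      (m + 1) ^ (k - 1) / (\<Prod>l=1..k. 1 + (m + 1) * eps \<omega> t l)"
  proof (rule sum_R_coeff[OF t])
    \<comment> \<open>Adding \<open>m + a (r + l) > - 1\<close> and \<open>kappa > 0\<close>
      eliminates \<open>a (r + l)\<close>.\<close>
    show "m + 1 + t * \<omega> l > 0" if "l \<in> {1..k}" for l
    proof -
      have "l \<in> {1..s}" "r + l \<in> {1..r + s}" using k that by auto
      then show ?thesis using kappa[of l] a[of "r + l"] by (auto simp: kappa_def)
    qed
  qed (use k \<omega> inj in \<open>auto intro: inj_on_subset\<close>)
  finally show ?thesis .
qed

section \<open>From power moments to step-line moment matrices\<close>

lemma moment_matrix_eqI:
  assumes "has_moment (U (N mod q + 1)) (real (N div q) + real (M div p) + \<beta> (M mod p + 1)) v"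
    and "I \<subseteq> {0<..}" "\<And>x. x > 0 \<Longrightarrow> x \<notin> I \<Longrightarrow> U (N mod q + 1) x = 0"
  shows "moment_matrix I p q U \<beta> N M = v"
proof -
  let ?m = "real (N div q) + real (M div p) + \<beta> (M mod p + 1)"
  have "indicator I x *\<^sub>R (step_line q U N x * step_line p (\<lambda>i x. x powr \<beta> i) M x) =
      indicator {0<..} x * (x powr ?m * U (N mod q + 1) x)" for x
  proof (cases "x > 0")
    case True
    then have "x powr ?m = x ^ (N div q) * x ^ (M div p) * x powr \<beta> (M mod p + 1)"
      by (simp add: powr_add powr_realpow)
    then show ?thesis using True assms(3)[of x]
      by (cases "x \<in> I") (simp_all add: step_line_def)
  next
    case False
    then have "x \<notin> I" using assms(2) by auto
    then show ?thesis using False by simp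
  qed
  then show ?thesis
    using assms(1) unfolding moment_matrix_def set_lebesgue_integral_def has_moment_def
    by (simp add: has_bochner_integral_integral_eq)
qed

lemma jacobi_w_eq_0:
  assumes "q \<ge> 1" "x \<ge> 1"
  shows "jacobi_w q a b j x = 0"
  unfolding jacobi_w_def by (rule mellin_convs_eq_0) (use assms in \<open>auto simp: beta_weight_def\<close>)

text \<open>Allows the integral over the bounded interval to be taken over the half-line, where
  moments of convolutions multiply.\<close>

lemma U_hat_eq_0:
  assumes "r + s \<ge> 1" "c_scale r s a \<omega> t > 0" "x \<ge> c_scale r s a \<omega> t"
  shows "U_hat r s a b \<omega> t j x = 0"
  using assms by (simp add: U_hat_def V_hat_def scaled_jacobi_def jacobi_w_eq_0)

lemma eventually_kappa_pos:
  assumes "\<And>l. l \<in> {1..s} \<Longrightarrow> \<omega> l > 0"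
  shows "\<forall>\<^sub>F t in at_top. \<forall>l\<in>{1..s}. kappa r a \<omega> t l > 0"
proof (rule eventually_ball_finite)
  show "\<forall>l\<in>{1..s}. \<forall>\<^sub>F t in at_top. kappa r a \<omega> t l > 0"
  proof
    fix l assume "l \<in> {1..s}"
    then have "\<omega> l > 0" by (rule assms)
    then show "\<forall>\<^sub>F t in at_top. kappa r a \<omega> t l > 0" unfolding kappa_def by real_asymp
  qed
qed simp

lemma eps_tendsto_0:
  assumes "\<omega> l > 0"
  shows "((\<lambda>t. eps \<omega> t l) \<longlongrightarrow> 0) at_top"
  unfolding eps_def using assms by real_asymp

text \<open>Both entries contain the same \<open>lag_moment\<close>, and \<open>gamma_ratio\<close>
  tends to one, so only the rational factors \<open>w\<close> and \<open>v\<close> remain to be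
  compared.\<close>

lemma jacobi_moments_tendsto:
  fixes p r s :: nat and a b \<beta> \<omega> :: "nat \<Rightarrow> real"
  assumes p: "p \<ge> 1" and s: "s \<ge> 1"
    and b: "\<And>h. h \<in> {1..r} \<Longrightarrow> a h < b h"
    and \<beta>: "\<And>i j. i \<in> {1..p} \<Longrightarrow> j \<in> {1..r + s} \<Longrightarrow> \<beta> i + a j > - 1"
    and \<omega>: "\<And>l. l \<in> {1..s} \<Longrightarrow> \<omega> l > 0" and inj: "inj_on \<omega> {1..s}"
  shows "((\<lambda>t. jacobi_moments p r s a b \<beta> \<omega> t N M) \<longlongrightarrow> laguerre_moments p r s a b \<beta> N M) at_top"
proof -
  define j where "j = N mod (r + s) + 1"
  define m where "m = real (N div (r + s)) + real (M div p) + \<beta> (M mod p + 1)"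
  have j: "j \<in> {1..r + s}" using s by (auto simp: j_def Suc_le_eq)
  have "M mod p + 1 \<in> {1..p}" using p by (auto simp: Suc_le_eq)
  \<comment> \<open>The step-line powers are nonnegative and only raise the exponent above the
    column parameter.\<close>
  then have a: "m + a i > - 1" if "i \<in> {1..r + s}" for i
    using \<beta>[of "M mod p + 1" i] that by (simp add: m_def)
  let ?\<Phi> = "lag_moment r s a b m"
  define v where "v = (if j \<le> r then 1 / (m + b j + 1) else (m + 1) ^ (j - r - 1))"
  define w where "w t = (if j \<le> r then 1 / (m + b j + 1)
      else (m + 1) ^ (j - r - 1) / (\<Prod>l=1..j - r. 1 + (m + 1) * eps \<omega> t l))" for t
  have "has_moment (laguerre_vec r s a b j) m (?\<Phi> * v)"
  proof (cases "j \<le> r")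
    case True
    have "has_moment (laguerre_w r s a b j) m (?\<Phi> * (1 / (m + b j + 1)))"
      by (rule has_moment_laguerre_w) (use a b j True in auto)
    then show ?thesis using True by (simp add: laguerre_vec_def v_def)
  next
    case False
    have "has_moment (laguerre_v r s a b (j - r)) m (?\<Phi> * (m + 1) ^ (j - r - 1))"
      by (rule has_moment_laguerre_v) (use a b j False in auto)
    then show ?thesis using False by (simp add: laguerre_vec_def v_def)
  qed
  then have L: "laguerre_moments p r s a b \<beta> N M = ?\<Phi> * v"
    unfolding laguerre_moments_def j_def m_def by (intro moment_matrix_eqI) auto
  have kappa: "\<forall>\<^sub>F t in at_top. \<forall>l\<in>{1..s}. kappa r a \<omega> t l > 0"
    by (rule eventually_kappa_pos) (rule \<omega>)
  \<comment> \<open>Valid for large \<open>t\<close> only: the Jacobi moment formulas need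
    \<open>t\<close> and every \<open>kappa\<close> positive.\<close>
  have J: "\<forall>\<^sub>F t in at_top. ?\<Phi> * gamma_ratio r s a \<omega> m t * w t = jacobi_moments p r s a b \<beta> \<omega> t N M"
    using kappa eventually_gt_at_top[of 0]
  proof eventually_elim
    case (elim t)
    have c: "c_scale r s a \<omega> t > 0"
      unfolding c_scale_def by (rule prod_pos) (use elim in auto)
    have "has_moment (U_hat r s a b \<omega> t j) m (?\<Phi> * gamma_ratio r s a \<omega> m t * w t)"
    proof (cases "j \<le> r")
      case True
      have "has_moment (scaled_jacobi r s a b \<omega> t j) m
          (?\<Phi> * gamma_ratio r s a \<omega> m t * (1 / (m + jacobi_b r b \<omega> t j + 1)))"
        by (rule has_moment_scaled_jacobi) (use a b j elim in auto)
      then show ?thesis using True by (simp add: U_hat_def w_def jacobi_b_def)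
    next
      case False
      have "has_moment (V_hat r s a b \<omega> t (j - r)) m (?\<Phi> * gamma_ratio r s a \<omega> m t *
          ((m + 1) ^ (j - r - 1) / (\<Prod>l=1..j - r. 1 + (m + 1) * eps \<omega> t l)))"
        by (rule has_moment_V_hat) (use a b j elim \<omega> inj False in auto)
      then show ?thesis using False by (simp add: U_hat_def w_def)
    qed
    then have "jacobi_moments p r s a b \<beta> \<omega> t N M = ?\<Phi> * gamma_ratio r s a \<omega> m t * w t"
      unfolding jacobi_moments_def j_def m_def
      by (intro moment_matrix_eqI) (use s c U_hat_eq_0[of r s a \<omega> t] in auto)
    then show ?case by simp
  qed
  have "(w \<longlongrightarrow> v) at_top"
  proof (cases "j \<le> r")
    case False
    have "((\<lambda>t. \<Prod>l=1..j - r. 1 + (m + 1) * eps \<omega> t l) \<longlongrightarrow> (\<Prod>l=1..j - r. 1 + (m + 1) * 0)) at_top"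
      by (intro tendsto_intros tendsto_prod eps_tendsto_0 \<omega>) (use j in auto)
    then have "((\<lambda>t. (m + 1) ^ (j - r - 1) / (\<Prod>l=1..j - r. 1 + (m + 1) * eps \<omega> t l)) \<longlongrightarrow>
        (m + 1) ^ (j - r - 1) / 1) at_top"
      by (intro tendsto_intros) auto
    then show ?thesis using False by (simp add: w_def[abs_def] v_def)
  qed (simp add: w_def[abs_def] v_def)
  then have "((\<lambda>t. ?\<Phi> * gamma_ratio r s a \<omega> m t * w t) \<longlongrightarrow> ?\<Phi> * 1 * v) at_top"
    by (intro tendsto_intros gamma_ratio_tendsto a \<omega>)
  then show ?thesis unfolding L using J by (simp add: Lim_transform_eventually)
qed

theorem proposition3p3:
  fixes p r s K :: nat
    and a b \<beta> \<omega> :: "nat \<Rightarrow> real"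
  assumes "p \<ge> 1" and "s \<ge> 1"
    and "\<forall>j \<in> {1..r + s}. a j > - 1"
    and "\<forall>h \<in> {1..r}. b h > - 1 \<and> a h < b h"
    and "\<forall>i \<in> {1..p}. \<forall>j \<in> {1..r + s}. \<beta> i + a j > - 1"
    and "\<forall>l \<in> {1..s}. \<omega> l > 0" and "inj_on \<omega> {1..s}"
    and "used_minors_nonzero p (r + s) K (laguerre_moments p r s a b \<beta>)"
  shows "(\<forall>\<^sub>F t in at_top. used_minors_nonzero p (r + s) K (jacobi_moments p r s a b \<beta> \<omega> t)) \<and>
    (\<forall>N \<le> K. \<forall>M.
      ((\<lambda>t. A_coeff (jacobi_moments p r s a b \<beta> \<omega> t) N M)
         \<longlongrightarrow> A_coeff (laguerre_moments p r s a b \<beta>) N M) at_top \<and>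
      ((\<lambda>t. B_coeff (jacobi_moments p r s a b \<beta> \<omega> t) N M)
         \<longlongrightarrow> B_coeff (laguerre_moments p r s a b \<beta>) N M) at_top \<and>
      ((\<lambda>t. recurrence_matrix (r + s) (jacobi_moments p r s a b \<beta> \<omega> t) N M)
         \<longlongrightarrow> recurrence_matrix (r + s) (laguerre_moments p r s a b \<beta>) N M) at_top \<and>
      (\<forall>k \<in> {1..p}.
        ((\<lambda>t. lower_factor (jacobi_moments p r s a b \<beta> \<omega> t) k N M)
           \<longlongrightarrow> lower_factor (laguerre_moments p r s a b \<beta>) k N M) at_top) \<and>
      (\<forall>k \<in> {1..r + s}.
        ((\<lambda>t. upper_factor (jacobi_moments p r s a b \<beta> \<omega> t) k N M)
           \<longlongrightarrow> upper_factor (laguerre_moments p r s a b \<beta>) k N M) at_top))"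
proof -
  have lim: "((\<lambda>t. jacobi_moments p r s a b \<beta> \<omega> t i j) \<longlongrightarrow> laguerre_moments p r s a b \<beta> i j) at_top"
    for i j
    by (rule jacobi_moments_tendsto) (use assms in auto)
  have q: "r + s \<ge> 1" using assms(2) by simp
  note conv = gauss_borel_objects_converge[OF lim q assms(8)]
  show ?thesis by (intro conjI allI impI ballI conv)
qed

end
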